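(* Let $d\ge 2$ be an integer. Let the constants $c_k$ ($k\ge 0$) be defined recursively by $c_0=c_1=1$ and $$c_{ds+b}=\binom{d}{b}\,\frac{c_s^{\,d-b}\, c_{s+1}^{\,b}}{d^{ds+b}-d}$$ for all integers $s\ge 0$ and $b\in\{0,1,\ldots,d-1\}$ with $ds+b\ge 2$. Then for every $k\ge 1$, the $d$-ary inducibility of the even $d$-ary tree $E_k^d$ is $I_d(E_k^d)=k!\,c_k$.
   Context: A $d$-ary tree is a finite rooted tree in which every internal (non-leaf) vertex has at least two and at most $d$ children; a single vertex is a $d$-ary tree with one leaf. Isomorphism of rooted trees means root-preserving isomorphism. $\|T\|$ denotes the number of leaves of $T$. A set $S$ of leaves of $T$ induces a $d$-ary tree: take the smallest subtree of $T$ containing all leaves in $S$ (rooted at the most recent common ancestor of $S$) and repeatedly suppress every vertex with exactly one child (contracting its two adjacent edges to a single edge). $c(D,T)$ is the number of sets of $\|D\|$ leaves of $T$ that induce a tree isomorphic to $D$, and $\gamma(D,T)=c(D,T)/\binom{\|T\|}{\|D\|}$. The $d$-ary inducibility of a $d$-ary tree $D$ is $$I_d(D)=\limsup_{n\to\infty}\ \max_{\substack{\|T\|=n\\ T\ d\text{-ary tree}}}\gamma(D,T).$$ Even $d$-ary trees $E_k^d$ (with $k$ leaves) are defined recursively: $E_1^d$ is a single vertex; for $2\le k\le d$, $E_k^d$ is the star consisting of a root and $k$ leaves attached to it; for $k>d$, write $k=ds+b$ with $b\in\{0,1,\ldots,d-1\}$, take $d-b$ copies of $E_s^d$ and $b$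 copies of $E_{s+1}^d$, and connect a new common root to each of their roots by an edge to obtain $E_k^d$. *)

theory Defs
  imports Complex_Main "HOL-Library.Sublist" "HOL-Library.Extended_Real"
begin

text \<open>
  A finite rooted tree is represented by a plane tree; the order of the children is
  disregarded by \<open>isomorphic\<close> below. Vertices are addressed by the list of child indices on
  the path from the root, so the root is \<open>[]\<close> and the ancestors of a vertex are the prefixes
  of its address.
\<close>

datatype rtree = Node (children: "rtree list")

fun subtree_at :: "rtree \<Rightarrow> nat list \<Rightarrow> rtree option" where
  "subtree_at t [] = Some t"
| "subtree_at t (i # p) =
     (if i < length (children t) then subtree_at (children t ! i) p else None)"

definition vertices :: "rtree \<Rightarrow> nat list set" where
  "vertices t = {p. subtree_at t p \<noteq> None}"

definition leaves :: "rtree \<Rightarrow> nat list set" where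
  "leaves t = {p. subtree_at t p = Some (Node [])}"

definition num_leaves :: "rtree \<Rightarrow> nat" where
  "num_leaves t = card (leaves t)"

definition adjacent :: "nat list \<Rightarrow> nat list \<Rightarrow> bool" where
  "adjacent p q \<longleftrightarrow> (\<exists>i. q = p @ [i] \<or> p = q @ [i])"

definition isomorphic :: "rtree \<Rightarrow> rtree \<Rightarrow> bool" where
  "isomorphic t u \<longleftrightarrow>
     (\<exists>f. bij_betw f (vertices t) (vertices u) \<and> f [] = [] \<and>
          (\<forall>p\<in>vertices t. \<forall>q\<in>vertices t. adjacent p q \<longleftrightarrow> adjacent (f p) (f q)))"

definition dary :: "nat \<Rightarrow> rtree \<Rightarrow> bool" where
  "dary d t \<longleftrightarrow>
     (\<forall>p ts. subtree_at t p = Some (Node ts) \<and> ts \<noteq> [] \<longrightarrow> 2 \<le> length ts \<and> length ts \<le> d)"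

text \<open>
  For a set \<open>S\<close> of leaf addresses, \<open>prune S t\<close> keeps exactly the root and the vertices of
  \<open>t\<close> that have a descendant (possibly themselves) in \<open>S\<close>.
\<close>

function prune :: "nat list set \<Rightarrow> rtree \<Rightarrow> rtree" where
  "prune S (Node ts) =
     Node (map (\<lambda>i. prune {p. i # p \<in> S} (ts ! i))
               (filter (\<lambda>i. \<exists>p. i # p \<in> S) [0..<length ts]))"
  by pat_completeness auto
termination
  by (relation "measure (size \<circ> snd)") (auto simp: less_Suc_eq_le intro!: size_list_estimation')


text \<open>
  The most recent common ancestor of \<open>S\<close> is the longest common prefix of its addresses. Inside
  the subtree rooted there, the leaf \<open>m @ q\<close> has the address \<open>q\<close>.
\<close>

definition spanned_subtree :: "rtree \<Rightarrow> nat list set \<Rightarrow> rtree" where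
  "spanned_subtree t S =
     (let m = Longest_common_prefix S in prune {q. m @ q \<in> S} (the (subtree_at t m)))"

fun suppress :: "rtree \<Rightarrow> rtree" where
  "suppress (Node ts) = (case map suppress ts of [t] \<Rightarrow> t | us \<Rightarrow> Node us)"

definition induced_tree :: "rtree \<Rightarrow> nat list set \<Rightarrow> rtree" where
  "induced_tree t S = suppress (spanned_subtree t S)"

definition copies :: "rtree \<Rightarrow> rtree \<Rightarrow> nat" where
  "copies D T =
     card {S. S \<subseteq> leaves T \<and> card S = num_leaves D \<and> isomorphic (induced_tree T S) D}"

definition density :: "rtree \<Rightarrow> rtree \<Rightarrow> real" where
  "density D T = real (copies D T) / real (num_leaves T choose num_leaves D)"

text \<open>
  For \<open>d \<ge> 2\<close> the maximum is over a nonempty finite set for every \<open>n \<ge> 1\<close>; the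
  unspecified value at \<open>n = 0\<close> does not affect the limit superior.
\<close>

definition inducibility :: "nat \<Rightarrow> rtree \<Rightarrow> ereal" where
  "inducibility d D =
     limsup (\<lambda>n. ereal (Max {density D T | T. dary d T \<and> num_leaves T = n}))"

text \<open>Only \<open>d \<ge> 2\<close> and \<open>k \<ge> 1\<close> are meaningful; the other values are dummies.\<close>

function even_tree :: "nat \<Rightarrow> nat \<Rightarrow> rtree" where
  "even_tree d k =
     (if d < 2 \<or> k \<le> 1 then Node []
      else if k \<le> d then Node (replicate k (Node []))
      else Node (replicate (d - k mod d) (even_tree d (k div d)) @
                 replicate (k mod d) (even_tree d (k div d + 1))))"
  by auto
termination
proof (relation "measure snd")
  fix d k :: nat
  assume a: "\<not> (d < 2 \<or> k \<le> 1)" "\<not> k \<le> d"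
  then have "k div d \<le> k div 2"
    by (intro div_le_mono2) auto
  moreover have "3 \<le> k"
    using a by simp
  then have "k div 2 + 1 < k"
    by presburger
  ultimately have "k div d + 1 < k"
    by (rule order.strict_trans1[OF add_right_mono])
  then show "((d, k div d + 1), (d, k)) \<in> measure snd"
    by simp
qed auto

declare even_tree.simps [simp del]

end

theory Submission
  imports Defs "HOL-Combinatorics.Permutations" "HOL-Library.FuncSet" "HOL-Library.Multiset"
begin

text \<open>
  Isomorphism classes of rooted trees are encoded as nested multisets. If the children of the root
  of \<open>T\<close> are padded to exactly \<open>d\<close> possibly empty branches \<open>T\<^sub>1, \<dots>, T\<^sub>d\<close> and \<open>E\<^sub>0\<close> is the empty tree,
  then for \<open>k = d s + b \<ge> 2\<close> the number \<open>N\<^sub>k(T)\<close> of copies of \<open>E\<^sub>k\<close> satisfies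
  \<open>N\<^sub>k(T) = (\<Sum>i. N\<^sub>k(T\<^sub>i)) + (\<Sum>B. (\<Prod>i\<in>B. N\<^sub>s\<^sub>+\<^sub>1(T\<^sub>i)) * (\<Prod>i\<notin>B. N\<^sub>s(T\<^sub>i)))\<close>, where \<open>B\<close> ranges over the
  \<open>b\<close>-element sets of branches. By induction on \<open>T\<close> the bound \<open>N\<^sub>k(T) \<le> c\<^sub>k n\<^sup>k\<close> for \<open>n\<close> leaves reduces to
  Muirhead's inequality: \<open>(\<Sum>x\<^sub>i)\<^sup>k - \<Sum>x\<^sub>i\<^sup>k\<close> is a sum of \<open>d\<^sup>k - d\<close> monomials of degree \<open>k\<close>, and after
  symmetrisation each of them dominates the monomial whose exponents are as equal as possible. On
  complete \<open>d\<close>-ary trees the recursion is linear and \<open>N\<^sub>k / n\<^sup>k\<close> tends to \<open>c\<^sub>k\<close>.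
\<close>

section \<open>Isomorphism as equality of nested multisets\<close>

text \<open>Forgetting the order of the children at every level turns isomorphism into equality of
  canonical forms, so that copies can be counted as leaf sets with a prescribed value.\<close>

datatype utree = UNode "utree multiset"

primrec uleaves :: "utree \<Rightarrow> nat" where
  "uleaves (UNode M) = (if M = {#} then 1 else sum_mset (image_mset uleaves M))"

primrec canon :: "rtree \<Rightarrow> utree" where
  "canon (Node ts) = UNode (mset (map canon ts))"

section \<open>Vertex addresses, adjacency and canonical forms\<close>

lemma in_vertices_simps [simp]:
  "[] \<in> vertices t"
  "i # p \<in> vertices (Node ts) \<longleftrightarrow> i < length ts \<and> p \<in> vertices (ts ! i)"
  by (auto simp: vertices_def)

lemma vertices_Node_cases:
  assumes "v \<in> vertices (Node ts)"
  obtains "v = []" | i p where "v = i # p" "i < length ts" "p \<in> vertices (ts ! i)"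
  using assms by (cases v) auto

lemma in_leaves_simps [simp]:
  "[] \<in> leaves (Node ts) \<longleftrightarrow> ts = []"
  "i # p \<in> leaves (Node ts) \<longleftrightarrow> i < length ts \<and> p \<in> leaves (ts ! i)"
  by (auto simp: leaves_def)

lemma vertices_butlast: "p @ [j] \<in> vertices t \<Longrightarrow> p \<in> vertices t"
proof (induction p arbitrary: t)
  case (Cons i p)
  then show ?case by (cases t) auto
qed simp

lemma adjacent_Cons [simp]:
  "adjacent (i # p) (j # q) \<longleftrightarrow> i = j \<and> adjacent p q"
  by (auto simp: adjacent_def)

lemma not_adjacent_Nil_Cons [simp]:
  "adjacent [] (j # q) \<longleftrightarrow> q = []" "adjacent (j # q) [] \<longleftrightarrow> q = []"
  by (auto simp: adjacent_def)

lemma not_adjacent_Nil_Nil [simp]: "\<not> adjacent [] []"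
  by (auto simp: adjacent_def)

text \<open>Induction along the path from the root. The image of a child is adjacent to the image of
  its parent, hence a child or the parent of that image; the latter is already the image of the
  grandparent, and injectivity excludes it.\<close>

lemma adjacency_preserving_extends:
  assumes inj: "inj_on f (vertices t)" and root: "f [] = []"
    and adj: "\<And>p q. p \<in> vertices t \<Longrightarrow> q \<in> vertices t \<Longrightarrow> adjacent p q \<Longrightarrow> adjacent (f p) (f q)"
    and v: "p @ [j] \<in> vertices t"
  shows "\<exists>j'. f (p @ [j]) = f p @ [j']"
  using v
proof (induction p arbitrary: j rule: rev_induct)
  case Nil
  then have "adjacent (f []) (f [j])"
    by (intro adj) (auto simp: adjacent_def)
  then show ?case by (auto simp: root adjacent_def)
next
  case (snoc l q)
  have q: "q @ [l] \<in> vertices t" "q \<in> vertices t"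
    using snoc.prems vertices_butlast by blast+
  then obtain l' where l': "f (q @ [l]) = f q @ [l']"
    using snoc.IH by blast
  have "adjacent (f (q @ [l])) (f ((q @ [l]) @ [j]))"
    using q snoc.prems by (intro adj) (auto simp: adjacent_def)
  moreover have "f ((q @ [l]) @ [j]) \<noteq> f q"
    using inj q snoc.prems by (auto dest: inj_onD)
  ultimately show ?case
    using l' by (auto simp: adjacent_def)
qed

lemma mset_map_nth: "mset (map f xs) = image_mset (\<lambda>i. f (xs ! i)) (mset_set {..<length xs})"
proof -
  have "mset (map f xs) = mset (map f (map ((!) xs) [0..<length xs]))"
    by (simp only: map_nth)
  then show ?thesis
    by (simp del: map_nth add: multiset.map_comp comp_def atLeast0LessThan)
qed

text \<open>The isomorphism acts on the children of the root by a bijection \<open>\<pi>\<close> of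
  indices and restricts to an isomorphism \<open>g i\<close> from branch \<open>i\<close> onto
  branch \<open>\<pi> i\<close>. By induction these have equal canonical forms, and reindexing along
  \<open>\<pi>\<close> matches the two multisets.\<close>

lemma isomorphic_imp_canon_eq: "isomorphic t u \<Longrightarrow> canon t = canon u"
proof (induction t arbitrary: u)
  case (Node ts)
  obtain us where u: "u = Node us" by (cases u)
  obtain f where bij: "bij_betw f (vertices (Node ts)) (vertices (Node us))" and root: "f [] = []"
    and adj: "\<And>p q. p \<in> vertices (Node ts) \<Longrightarrow> q \<in> vertices (Node ts) \<Longrightarrow>
       adjacent p q \<longleftrightarrow> adjacent (f p) (f q)"
    using Node.prems unfolding u isomorphic_def by blast
  have inj: "inj_on f (vertices (Node ts))"
    using bij by (rule bij_betw_imp_inj_on)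
  have ext: "\<exists>j'. f (p @ [j]) = f p @ [j']" if "p @ [j] \<in> vertices (Node ts)" for p j
    using adjacency_preserving_extends[OF inj root _ that] adj by blast
  define \<pi> where "\<pi> i = hd (f [i])" for i
  have f1: "f [i] = [\<pi> i]" if "i < length ts" for i
    using ext[of "[]" i] that by (auto simp: root \<pi>_def)
  \<comment> \<open>Descendants of \<open>[i]\<close> stay below \<open>[\<pi> i]\<close>, so
    dropping the first index of the image gives a map of branches. The depth is tracked so that this
    map sends root to root.\<close>
  have fC: "\<exists>q. f (i # p) = \<pi> i # q \<and> length q = length p" if "i # p \<in> vertices (Node ts)" for i p
    using that
  proof (induction p rule: rev_induct)
    case Nil
    then show ?case using f1 by auto
  next
    case (snoc l p)
    have "(i # p) @ [l] \<in> vertices (Node ts)"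
      using snoc.prems by simp
    then obtain l' where "f ((i # p) @ [l]) = f (i # p) @ [l']" and "i # p \<in> vertices (Node ts)"
      using ext vertices_butlast by blast
    then show ?case using snoc.IH by auto
  qed
  define g where "g i p = tl (f (i # p))" for i p
  have fg: "f (i # p) = \<pi> i # g i p \<and> length (g i p) = length p"
    if "i < length ts" "p \<in> vertices (ts ! i)" for i p
    using fC[of i p] that by (auto simp: g_def)
  have \<pi>_lt: "\<pi> i < length us" if "i < length ts" for i
    using bij_betwE[OF bij] that f1[OF that] by (auto dest!: bspec[of _ _ "[i]"])
  have \<pi>_inj: "inj_on \<pi> {..<length ts}"
  proof (rule inj_onI)
    fix i j assume "i \<in> {..<length ts}" "j \<in> {..<length ts}" "\<pi> i = \<pi> j"
    then have "f [i] = f [j]" "[i] \<in> vertices (Node ts)" "[j] \<in> vertices (Node ts)"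
      using f1 by auto
    then show "i = j" using inj by (auto dest: inj_onD)
  qed
  have surj: "\<exists>i p. i < length ts \<and> p \<in> vertices (ts ! i) \<and> \<pi> i = j \<and> g i p = q"
    if "j < length us" "q \<in> vertices (us ! j)" for j q
  proof -
    have "j # q \<in> f ` vertices (Node ts)"
      using that bij by (auto simp: bij_betw_def)
    then obtain v where v: "v \<in> vertices (Node ts)" "f v = j # q" by auto
    then show ?thesis
      using root fg by (elim vertices_Node_cases) auto
  qed
  have \<pi>_im: "\<pi> ` {..<length ts} = {..<length us}"
    using \<pi>_lt surj[where q = "[]"] by auto
  have "canon (ts ! i) = canon (us ! \<pi> i)" if i: "i < length ts" for i
  proof -
    have "inj_on (g i) (vertices (ts ! i))"
    proof (rule inj_onI)
      fix p q assume pq: "p \<in> vertices (ts ! i)" "q \<in> vertices (ts ! i)" "g i p = g i q"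
      then have "f (i # p) = f (i # q)" using fg i by auto
      then have "i # p = i # q"
        using inj_onD[OF inj, of "i # p" "i # q"] pq i by simp
      then show "p = q" by simp
    qed
    moreover have "g i ` vertices (ts ! i) = vertices (us ! \<pi> i)"
    proof (intro equalityI subsetI)
      fix q assume "q \<in> g i ` vertices (ts ! i)"
      then obtain p where p: "p \<in> vertices (ts ! i)" "q = g i p" by auto
      then have "f (i # p) \<in> vertices (Node us)"
        using bij_betwE[OF bij] i by auto
      then show "q \<in> vertices (us ! \<pi> i)" using fg[OF i p(1)] p by simp
    next
      fix q assume "q \<in> vertices (us ! \<pi> i)"
      then obtain j p where "j < length ts" "p \<in> vertices (ts ! j)" "\<pi> j = \<pi> i" "g j p = q"
        using surj[OF \<pi>_lt[OF i]] by blast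
      moreover from this have "j = i" using inj_onD[OF \<pi>_inj] i by simp
      ultimately show "q \<in> g i ` vertices (ts ! i)" by auto
    qed
    moreover have "g i [] = []" using fg[OF i, of "[]"] by simp
    moreover have "adjacent p q \<longleftrightarrow> adjacent (g i p) (g i q)"
      if "p \<in> vertices (ts ! i)" "q \<in> vertices (ts ! i)" for p q
      using adj[of "i # p" "i # q"] fg[OF i that(1)] fg[OF i that(2)] i that by simp
    ultimately have "isomorphic (ts ! i) (us ! \<pi> i)"
      unfolding isomorphic_def bij_betw_def by blast
    then show ?thesis
      using Node.IH i by simp
  qed
  then have "image_mset (\<lambda>i. canon (ts ! i)) (mset_set {..<length ts}) =
      image_mset (\<lambda>i. canon (us ! \<pi> i)) (mset_set {..<length ts})"
    by (intro image_mset_cong) auto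
  also have "\<dots> = image_mset (\<lambda>i. canon (us ! i)) (image_mset \<pi> (mset_set {..<length ts}))"
    by (simp add: multiset.map_comp comp_def)
  also have "\<dots> = image_mset (\<lambda>i. canon (us ! i)) (mset_set {..<length us})"
    by (simp add: image_mset_mset_set[OF \<pi>_inj] \<pi>_im)
  finally have "mset (map canon ts) = mset (map canon us)"
    by (simp add: mset_map_nth del: mset_map)
  then show ?case by (simp add: u)
qed


text \<open>Equality of the multisets supplies a permutation matching children with equal canonical
  forms. The isomorphisms of the branches are glued by letting \<open>\<pi>\<close> act on the first
  index of an address and \<open>g i\<close> on the rest.\<close>

lemma canon_eq_imp_isomorphic: "canon t = canon u \<Longrightarrow> isomorphic t u"
proof (induction t arbitrary: u)
  case (Node ts)
  obtain us where u: "u = Node us" by (cases u)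
  have "mset (map canon ts) = mset (map canon us)"
    using Node.prems by (simp add: u)
  then obtain \<pi> where \<pi>: "\<pi> permutes {..<length (map canon us)}"
      and perm: "permute_list \<pi> (map canon us) = map canon ts"
    by (rule mset_eq_permutation)
  from perm have "length (permute_list \<pi> (map canon us)) = length (map canon ts)" by (rule arg_cong)
  then have len: "length ts = length us" by simp
  from \<pi> have \<pi>_lt: "i < length us \<Longrightarrow> \<pi> i < length us" for i
    by (simp add: permutes_in_image flip: lessThan_iff)
  have nth: "canon (ts ! i) = canon (us ! \<pi> i)" if "i < length us" for i
  proof -
    have "map canon ts ! i = map canon us ! \<pi> i"
      using permute_list_nth[OF \<pi>, of i] that by (simp add: perm)
    then show ?thesis using that len \<pi>_lt by simp
  qed
  have "\<exists>f. bij_betw f (vertices (ts ! i)) (vertices (us ! \<pi> i)) \<and> f [] = [] \<and>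
      (\<forall>p\<in>vertices (ts ! i). \<forall>q\<in>vertices (ts ! i). adjacent p q \<longleftrightarrow> adjacent (f p) (f q))"
    if "i < length ts" for i
    using Node.IH[of "ts ! i" "us ! \<pi> i"] that nth[of i] len by (simp add: isomorphic_def)
  then obtain g where g: "\<And>i. i < length ts \<Longrightarrow>
      bij_betw (g i) (vertices (ts ! i)) (vertices (us ! \<pi> i)) \<and> g i [] = [] \<and>
      (\<forall>p\<in>vertices (ts ! i). \<forall>q\<in>vertices (ts ! i). adjacent p q \<longleftrightarrow> adjacent (g i p) (g i q))"
    by metis
  define f where "f v = (case v of [] \<Rightarrow> [] | i # p \<Rightarrow> \<pi> i # g i p)" for v
  have f_simps [simp]: "f [] = []" "f (i # p) = \<pi> i # g i p" for i p
    by (simp_all add: f_def)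
  have \<pi>_inj: "\<pi> i = \<pi> j \<longleftrightarrow> i = j" for i j
    using permutes_inj[OF \<pi>] by (auto dest: injD)
  have g_inj: "g i p = g i q \<longleftrightarrow> p = q"
    if "i < length ts" "p \<in> vertices (ts ! i)" "q \<in> vertices (ts ! i)" for i p q
    using g[OF that(1)] that(2,3) by (auto simp: bij_betw_def dest: inj_onD)
  have g_in: "g i p \<in> vertices (us ! \<pi> i)" if "i < length ts" "p \<in> vertices (ts ! i)" for i p
    using g[OF that(1)] that(2) by (auto simp: bij_betw_def)
  have "bij_betw f (vertices (Node ts)) (vertices (Node us))"
    unfolding bij_betw_def
  proof (intro conjI inj_onI equalityI subsetI)
    fix v w assume "v \<in> vertices (Node ts)" "w \<in> vertices (Node ts)" "f v = f w"
    then show "v = w"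
      by (elim vertices_Node_cases) (auto simp: \<pi>_inj g_inj)
  next
    fix w assume "w \<in> f ` vertices (Node ts)"
    then obtain v where "v \<in> vertices (Node ts)" "w = f v" by auto
    then show "w \<in> vertices (Node us)"
      by (elim vertices_Node_cases) (auto simp: g_in \<pi>_lt len)
  next
    fix w assume w: "w \<in> vertices (Node us)"
    show "w \<in> f ` vertices (Node ts)"
    proof (cases w)
      case Nil
      then show ?thesis by (auto intro!: image_eqI[of _ _ "[]"])
    next
      case (Cons j q)
      with w have jq: "j < length us" "q \<in> vertices (us ! j)" by auto
      have "j \<in> \<pi> ` {..<length us}"
        using permutes_image[OF \<pi>] jq by simp
      then obtain i where i: "i < length ts" "\<pi> i = j" using len by auto
      then obtain p where "p \<in> vertices (ts ! i)" "g i p = q"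
        using g[OF i(1)] jq by (force simp: bij_betw_def)
      then show ?thesis using Cons i by (auto intro!: image_eqI[of _ _ "i # p"])
    qed
  qed
  moreover have "adjacent v w \<longleftrightarrow> adjacent (f v) (f w)"
    if "v \<in> vertices (Node ts)" "w \<in> vertices (Node ts)" for v w
    using that
  proof (elim vertices_Node_cases)
    fix i p j q
    assume vw: "v = i # p" "w = j # q" and
      i: "i < length ts" "p \<in> vertices (ts ! i)" and j: "j < length ts" "q \<in> vertices (ts ! j)"
    show ?thesis
      using g[OF i(1)] i j by (auto simp: vw \<pi>_inj)
  next
    fix i p
    assume "v = i # p" "w = []" and i: "i < length ts" "p \<in> vertices (ts ! i)"
    \<comment> \<open>Adjacency of \<open>i # p\<close> to the root means \<open>p = []\<close>,
      which the injective root-preserving map \<open>g i\<close> both preserves and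
      reflects.\<close>
    then show ?thesis using g[OF i(1)] g_inj[OF i(1,2), of "[]"] by auto
  next
    fix i p
    assume "w = i # p" "v = []" and i: "i < length ts" "p \<in> vertices (ts ! i)"
    then show ?thesis using g[OF i(1)] g_inj[OF i(1,2), of "[]"] by auto
  qed auto
  ultimately show ?case
    unfolding isomorphic_def u by (intro exI[of _ f]) auto
qed

lemma isomorphic_iff_canon_eq: "isomorphic t u \<longleftrightarrow> canon t = canon u"
  using isomorphic_imp_canon_eq canon_eq_imp_isomorphic by blast

section \<open>Leaf counts and the arity condition, read off at the root\<close>

lemma leaves_Node:
  "ts \<noteq> [] \<Longrightarrow> leaves (Node ts) = (\<Union>i<length ts. (#) i ` leaves (ts ! i))"
proof (intro set_eqI)
  fix p assume "ts \<noteq> []"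
  then show "p \<in> leaves (Node ts) \<longleftrightarrow> p \<in> (\<Union>i<length ts. (#) i ` leaves (ts ! i))"
    by (cases p) auto
qed

lemma leaves_Node_Nil: "leaves (Node []) = {[]}"
proof (intro set_eqI)
  fix p show "p \<in> leaves (Node []) \<longleftrightarrow> p \<in> {[]}"
    by (cases p) auto
qed

lemma finite_leaves: "finite (leaves t)"
proof (induction t)
  case (Node ts)
  then show ?case by (cases "ts = []") (auto simp: leaves_Node_Nil leaves_Node)
qed

lemma num_leaves_Node_Nil: "num_leaves (Node []) = 1"
  by (simp add: num_leaves_def leaves_Node_Nil)

lemma num_leaves_Node:
  assumes "ts \<noteq> []"
  shows "num_leaves (Node ts) = (\<Sum>i<length ts. num_leaves (ts ! i))"
  unfolding num_leaves_def leaves_Node[OF assms]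
  by (subst card_UN_disjoint) (auto simp: finite_leaves card_image)

lemma num_leaves_eq_uleaves: "num_leaves t = uleaves (canon t)"
proof (induction t)
  case (Node ts)
  show ?case
  proof (cases "ts = []")
    case False
    have "uleaves (canon (Node ts)) = (\<Sum>i<length ts. uleaves (canon (ts ! i)))"
      using False by (simp add: mset_map_nth multiset.map_comp comp_def sum_unfold_sum_mset
          mset_set_empty_iff lessThan_empty_iff del: mset_map)
    then show ?thesis
      using Node.IH False by (simp add: num_leaves_Node)
  qed (simp add: num_leaves_Node_Nil)
qed

lemma dary_Node:
  "dary d (Node ts) \<longleftrightarrow> (ts \<noteq> [] \<longrightarrow> 2 \<le> length ts \<and> length ts \<le> d) \<and> (\<forall>t\<in>set ts. dary d t)"
  (is "?L \<longleftrightarrow> ?R")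
proof
  assume L: ?L
  have "dary d (ts ! i)" if "i < length ts" for i
    unfolding dary_def
  proof (intro allI impI)
    fix p us assume "subtree_at (ts ! i) p = Some (Node us) \<and> us \<noteq> []"
    then show "2 \<le> length us \<and> length us \<le> d"
      using L[unfolded dary_def, rule_format, of "i # p" us] that by simp
  qed
  moreover have "ts \<noteq> [] \<longrightarrow> 2 \<le> length ts \<and> length ts \<le> d"
    using L[unfolded dary_def, rule_format, of "[]" ts] by simp
  ultimately show ?R by (auto simp: in_set_conv_nth)
next
  assume R: ?R
  show ?L
    unfolding dary_def
  proof (intro allI impI)
    fix p us assume p: "subtree_at (Node ts) p = Some (Node us) \<and> us \<noteq> []"
    show "2 \<le> length us \<and> length us \<le> d"
    proof (cases p)
      case Nil
      then show ?thesis using p R by auto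
    next
      case (Cons i q)
      then have "i < length ts" "subtree_at (ts ! i) q = Some (Node us) \<and> us \<noteq> []"
        using p by (auto split: if_splits)
      then show ?thesis using R unfolding dary_def by (metis nth_mem)
    qed
  qed
qed

section \<open>Muirhead's inequality for balanced exponents\<close>

text \<open>With \<open>m = p - 1 - q\<close> the difference of the two sides is
  \<open>(x * y) ^ q * ((x ^ m - y ^ m) * (x - y))\<close>, and the last two factors have the same
  sign.\<close>

lemma power_exchange_le:
  fixes x y :: real
  assumes "x \<ge> 0" "y \<ge> 0" "q < p"
  shows "x ^ (p - 1) * y ^ (q + 1) + y ^ (p - 1) * x ^ (q + 1) \<le> x ^ p * y ^ q + y ^ p * x ^ q"
proof -
  define m where "m = p - 1 - q"
  have p: "p = Suc (q + m)" using assms(3) by (simp add: m_def)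
  have "0 \<le> (x ^ m - y ^ m) * (x - y)"
  proof (cases "x \<le> y")
    case True
    then show ?thesis using assms by (intro mult_nonpos_nonpos) (auto intro: power_mono)
  next
    case False
    then show ?thesis using assms by (intro mult_nonneg_nonneg) (auto intro!: power_mono)
  qed
  from mult_nonneg_nonneg[OF _ this] have "0 \<le> (x * y) ^ q * ((x ^ m - y ^ m) * (x - y))"
    using assms by simp
  also have "\<dots> = x ^ p * y ^ q + y ^ p * x ^ q - (x ^ (p - 1) * y ^ (q + 1) + y ^ (p - 1) * x ^ (q + 1))"
    by (simp add: p algebra_simps power_add power_mult_distrib)
  finally show ?thesis by simp
qed

text \<open>Muirhead's symmetric mean of the exponent vector \<open>a\<close>, multiplied by
  \<open>d!\<close>. Summing over permutations rather than over distinct monomials gives every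
  exponent vector the same number of terms.\<close>

definition symsum :: "nat \<Rightarrow> (nat \<Rightarrow> real) \<Rightarrow> (nat \<Rightarrow> nat) \<Rightarrow> real" where
  "symsum d x a = (\<Sum>\<sigma> | \<sigma> permutes {..<d}. \<Prod>i<d. x (\<sigma> i) ^ a i)"

lemma prod_remove2:
  fixes f :: "nat \<Rightarrow> real"
  assumes "i < d" "j < d" "i \<noteq> j"
  shows "(\<Prod>k<d. f k) = f i * f j * (\<Prod>k\<in>{..<d} - {i, j}. f k)"
proof -
  have "(\<Prod>k<d. f k) = f i * (\<Prod>k\<in>{..<d} - {i}. f k)"
    using assms by (subst prod.remove[of _ i]) auto
  also have "(\<Prod>k\<in>{..<d} - {i}. f k) = f j * (\<Prod>k\<in>{..<d} - {i} - {j}. f k)"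
    using assms by (subst prod.remove[of _ j]) auto
  also have "{..<d} - {i} - {j} = {..<d} - {i, j}" by auto
  finally show ?thesis by simp
qed

text \<open>When \<open>a i = a j + 1\<close> the exchange merely swaps the two exponents, so no separate treatment of
  permuted exponent vectors is needed below.\<close>

lemma symsum_exchange_le:
  assumes x: "\<And>i. i < d \<Longrightarrow> x i \<ge> 0" and ij: "i < d" "j < d" "i \<noteq> j" "a j < a i"
  shows "symsum d x (a(i := a i - 1, j := a j + 1)) \<le> symsum d x a"
proof -
  define \<tau> where "\<tau> = Transposition.transpose i j"
  have \<tau>: "\<tau> permutes {..<d}"
    unfolding \<tau>_def using ij by (intro permutes_swap_id) auto
  define P where "P \<sigma> e = (\<Prod>k<d. x (\<sigma> k) ^ e k)" for \<sigma> and e :: "nat \<Rightarrow> nat"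
  define R where "R \<sigma> = (\<Prod>k\<in>{..<d} - {i, j}. x (\<sigma> k) ^ a k)" for \<sigma>
  \<comment> \<open>Pairing \<open>\<sigma>\<close> with \<open>\<sigma> \<circ> \<tau>\<close>
    counts every permutation twice. The two terms of a pair differ only in which of two variables
    carries which exponent, so the two-variable inequality applies to each pair.\<close>
  have sym: "2 * symsum d x e = (\<Sum>\<sigma> | \<sigma> permutes {..<d}. P \<sigma> e + P (\<sigma> \<circ> \<tau>) e)" for e
    unfolding sum.distrib P_def symsum_def
    using sum_permutations_compose_right[OF \<tau>, of "\<lambda>\<sigma>. \<Prod>k<d. x (\<sigma> k) ^ e k"] by simp
  have tau: "\<tau> i = j" "\<tau> j = i" by (simp_all add: \<tau>_def)
  have P1: "P \<sigma> e = x (\<sigma> i) ^ e i * x (\<sigma> j) ^ e j * R \<sigma>"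
    "P (\<sigma> \<circ> \<tau>) e = x (\<sigma> j) ^ e i * x (\<sigma> i) ^ e j * R \<sigma>"
    if "\<And>k. k \<noteq> i \<Longrightarrow> k \<noteq> j \<Longrightarrow> e k = a k" for \<sigma> e
  proof -
    have "(\<Prod>k\<in>{..<d} - {i, j}. x (\<sigma> k) ^ e k) = R \<sigma>"
      unfolding R_def using that by (intro prod.cong) auto
    then show "P \<sigma> e = x (\<sigma> i) ^ e i * x (\<sigma> j) ^ e j * R \<sigma>"
      unfolding P_def by (subst prod_remove2[OF ij(1-3)]) simp
    have "(\<Prod>k\<in>{..<d} - {i, j}. x ((\<sigma> \<circ> \<tau>) k) ^ e k) = R \<sigma>"
      unfolding R_def using that by (intro prod.cong) (auto simp: \<tau>_def transpose_apply_other)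
    then show "P (\<sigma> \<circ> \<tau>) e = x (\<sigma> j) ^ e i * x (\<sigma> i) ^ e j * R \<sigma>"
      unfolding P_def by (subst prod_remove2[OF ij(1-3)]) (simp add: tau)
  qed
  let ?a = "a(i := a i - 1, j := a j + 1)"
  have "P \<sigma> ?a + P (\<sigma> \<circ> \<tau>) ?a \<le> P \<sigma> a + P (\<sigma> \<circ> \<tau>) a" if "\<sigma> permutes {..<d}" for \<sigma>
  proof -
    have "\<sigma> k < d" if "k < d" for k
      using permutes_in_image[OF \<open>\<sigma> permutes {..<d}\<close>, of k] that by simp
    then have "R \<sigma> \<ge> 0" "x (\<sigma> i) \<ge> 0" "x (\<sigma> j) \<ge> 0"
      unfolding R_def using x ij by (auto intro!: prod_nonneg)
    then have "(x (\<sigma> i) ^ (a i - 1) * x (\<sigma> j) ^ (a j + 1) + x (\<sigma> j) ^ (a i - 1) * x (\<sigma> i) ^ (a j + 1)) * R \<sigma>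
        \<le> (x (\<sigma> i) ^ a i * x (\<sigma> j) ^ a j + x (\<sigma> j) ^ a i * x (\<sigma> i) ^ a j) * R \<sigma>"
      using ij by (intro mult_right_mono power_exchange_le) auto
    moreover have "P \<sigma> ?a = x (\<sigma> i) ^ (a i - 1) * x (\<sigma> j) ^ (a j + 1) * R \<sigma>"
      "P (\<sigma> \<circ> \<tau>) ?a = x (\<sigma> j) ^ (a i - 1) * x (\<sigma> i) ^ (a j + 1) * R \<sigma>"
      using ij(3) by (subst P1; simp)+
    ultimately show ?thesis
      using P1[of a \<sigma>] by (simp add: distrib_right)
  qed
  then have "2 * symsum d x ?a \<le> 2 * symsum d x a"
    unfolding sym by (intro sum_mono) simp
  then show ?thesis by simp
qed

text \<open>Muirhead's inequality for a target \<open>e\<close> whose entries differ by at most one.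
  While \<open>a\<close> differs from \<open>e\<close>, one unit can be moved from a position of
  excess to one of deficit; this does not increase the symmetric sum and lowers the total excess,
  which is the induction measure.\<close>

lemma symsum_balanced_le:
  assumes x: "\<And>i. i < d \<Longrightarrow> x i \<ge> 0"
    and sum: "(\<Sum>i<d. a i) = (\<Sum>i<d. e i)"
    and bal: "\<And>i j. i < d \<Longrightarrow> j < d \<Longrightarrow> e j \<le> e i + 1"
  shows "symsum d x e \<le> symsum d x a"
  using sum
proof (induction "\<Sum>i<d. a i - e i" arbitrary: a rule: less_induct)
  case less
  show ?case
  proof (cases "\<exists>i<d. e i < a i")
    case False
    then have le: "a i \<le> e i" if "i < d" for i using that by (meson not_less)
    have "a i = e i" if "i < d" for i
    proof (rule ccontr)
      assume "a i \<noteq> e i"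
      then have "(\<Sum>i<d. a i) < (\<Sum>i<d. e i)"
        using le that by (intro sum_strict_mono_ex1) (auto intro!: bexI[of _ i] simp: le_neq_implies_less)
      then show False using less.prems by simp
    qed
    then show ?thesis by (simp add: symsum_def)
  next
    case True
    then obtain i where i: "i < d" "e i < a i" by blast
    have "\<exists>j<d. a j < e j"
    proof (rule ccontr)
      assume "\<not> ?thesis"
      then have "\<And>j. j < d \<Longrightarrow> e j \<le> a j" by (meson not_less)
      then have "(\<Sum>i<d. e i) < (\<Sum>i<d. a i)"
        using i by (intro sum_strict_mono_ex1) (auto intro!: bexI[of _ i] simp: not_less)
      then show False using less.prems by simp
    qed
    then obtain j where j: "j < d" "a j < e j" by blast
    \<comment> \<open>The chain \<open>a j < e j \<le> e i + 1 \<le> a i\<close> makes the exchange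
      from \<open>i\<close> to \<open>j\<close> admissible.\<close>
    have "e j \<le> e i + 1" using bal i j by blast
    then have ij: "i \<noteq> j" "a j < a i" using i j by auto
    let ?a = "a(i := a i - 1, j := a j + 1)"
    have dec: "?a k - e k \<le> a k - e k" for k using i j by auto
    have "(\<Sum>k<d. ?a k - e k) < (\<Sum>k<d. a k - e k)"
      using i j ij dec by (intro sum_strict_mono_ex1) (auto intro!: bexI[of _ i])
    moreover have "(\<Sum>k<d. ?a k) = (\<Sum>k<d. a k)"
    proof -
      have "(\<Sum>k<d. f k) = f i + (f j + (\<Sum>k\<in>{..<d} - {i} - {j}. f k))" for f :: "nat \<Rightarrow> nat"
        using i j ij by (simp add: sum.remove[of "{..<d}" i] sum.remove[of "{..<d} - {i}" j])
      from this[of a] this[of ?a] show ?thesis using ij by simp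
    qed
    ultimately have "symsum d x e \<le> symsum d x ?a"
      using less by simp
    also have "\<dots> \<le> symsum d x a"
      using x i j ij by (intro symsum_exchange_le) auto
    finally show ?thesis .
  qed
qed

text \<open>The single monomials need not be symmetric. If their total is, each of the
  \<open>d!\<close> permutations contributes that same total.\<close>

lemma sum_symsum:
  assumes "\<And>\<sigma>. \<sigma> permutes {..<d} \<Longrightarrow>
    (\<Sum>j\<in>J. \<Prod>i<d. x (\<sigma> i) ^ a j i) = (\<Sum>j\<in>J. \<Prod>i<d. x i ^ a j i)"
  shows "(\<Sum>j\<in>J. symsum d x (a j)) = fact d * (\<Sum>j\<in>J. \<Prod>i<d. x i ^ a j i)"
proof -
  have "(\<Sum>j\<in>J. symsum d x (a j)) = (\<Sum>\<sigma> | \<sigma> permutes {..<d}. \<Sum>j\<in>J. \<Prod>i<d. x (\<sigma> i) ^ a j i)"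
    unfolding symsum_def by (rule sum.swap)
  also have "\<dots> = (\<Sum>\<sigma> | \<sigma> permutes {..<d}. \<Sum>j\<in>J. \<Prod>i<d. x i ^ a j i)"
    by (rule sum.cong[OF refl]) (simp add: assms)
  also have "\<dots> = fact d * (\<Sum>j\<in>J. \<Prod>i<d. x i ^ a j i)"
    by (simp add: card_permutations)
  finally show ?thesis .
qed

lemma subset_monomials_symmetric:
  fixes x :: "nat \<Rightarrow> real"
  assumes \<sigma>: "\<sigma> permutes {..<d}"
  shows "(\<Sum>B | B \<subseteq> {..<d} \<and> card B = b. \<Prod>i<d. x (\<sigma> i) ^ (s + of_bool (i \<in> B))) =
         (\<Sum>B | B \<subseteq> {..<d} \<and> card B = b. \<Prod>i<d. x i ^ (s + of_bool (i \<in> B)))"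
proof (rule sum.reindex_bij_witness[of _ "(`) (inv \<sigma>)" "(`) \<sigma>"])
  fix B assume B: "B \<in> {B. B \<subseteq> {..<d} \<and> card B = b}"
  have \<sigma>_inj: "inj \<sigma>" using \<sigma> by (rule permutes_inj)
  show "inv \<sigma> ` \<sigma> ` B = B" using \<sigma>_inj by (simp add: image_inv_f_f)
  show "\<sigma> ` inv \<sigma> ` B = B" using permutes_surj[OF \<sigma>] by (simp add: image_f_inv_f)
  show "\<sigma> ` B \<in> {B. B \<subseteq> {..<d} \<and> card B = b}"
    using B \<sigma> \<sigma>_inj permutes_in_image[OF \<sigma>] by (auto simp: card_image inj_on_subset)
  have "inv \<sigma> permutes {..<d}" using \<sigma> by (rule permutes_inv)
  then show "inv \<sigma> ` B \<in> {B. B \<subseteq> {..<d} \<and> card B = b}"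
    using B permutes_in_image[of "inv \<sigma>" "{..<d}"] permutes_inj[of "inv \<sigma>" "{..<d}"]
    by (auto simp: card_image inj_on_subset)
  show "(\<Prod>i<d. x i ^ (s + of_bool (i \<in> \<sigma> ` B))) = (\<Prod>i<d. x (\<sigma> i) ^ (s + of_bool (i \<in> B)))"
    by (subst prod.permute[OF \<sigma>]) (simp add: comp_def inj_image_mem_iff[OF \<sigma>_inj])
qed

text \<open>Expanding the power of the sum assigns a variable to each of the \<open>k\<close>
  positions; the exponents are the fibre sizes of this assignment. The constant assignments account
  for the power sum, so the others form \<open>d ^ k - d\<close> monomials.\<close>

lemma nonconstant_functions_sum:
  fixes x :: "nat \<Rightarrow> real" and d k :: nat
  defines "J \<equiv> ({..<k} \<rightarrow>\<^sub>E {..<d}) - (\<lambda>i. \<lambda>j\<in>{..<k}. i) ` {..<d}"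
  assumes "k \<ge> 1"
  shows "(\<Sum>f\<in>J. \<Prod>i<d. x i ^ card {j. j < k \<and> f j = i}) = (\<Sum>i<d. x i) ^ k - (\<Sum>i<d. x i ^ k)"
    and "real (card J) = real d ^ k - real d"
proof -
  let ?C = "\<lambda>i. \<lambda>j\<in>{..<k}. i"
  have C_sub: "?C ` {..<d} \<subseteq> {..<k} \<rightarrow>\<^sub>E {..<d}"
    by (intro image_subsetI) (simp add: restrict_PiE_iff)
  have C_inj: "inj_on ?C {..<d}"
  proof (rule inj_onI)
    fix i i' assume "?C i = ?C i'"
    \<comment> \<open>Position 0 exists because \<open>k \<ge> 1\<close>; this is what keeps the
      \<open>d\<close> constant assignments distinct.\<close>
    then have "?C i 0 = ?C i' 0" by (rule fun_cong)
    then show "i = i'" using assms by simp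
  qed
  have fin: "finite ({..<k} \<rightarrow>\<^sub>E {..<d})" by (intro finite_PiE) auto
  have mono: "(\<Prod>i<d. x i ^ card {j. j < k \<and> f j = i}) = (\<Prod>j<k. x (f j))"
    if "f \<in> {..<k} \<rightarrow>\<^sub>E {..<d}" for f
  proof -
    have "(\<Prod>j<k. x (f j)) = (\<Prod>i<d. \<Prod>j\<in>{j\<in>{..<k}. f j = i}. x (f j))"
      using that by (intro prod.group[symmetric]) auto
    also have "\<dots> = (\<Prod>i<d. \<Prod>j\<in>{j\<in>{..<k}. f j = i}. x i)"
      by (intro prod.cong) auto
    also have "\<dots> = (\<Prod>i<d. x i ^ card {j. j < k \<and> f j = i})" by simp
    finally show ?thesis by simp
  qed
  have "(\<Sum>f\<in>J. \<Prod>i<d. x i ^ card {j. j < k \<and> f j = i}) = (\<Sum>f\<in>J. \<Prod>j<k. x (f j))"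
    unfolding J_def by (intro sum.cong) (auto simp: mono)
  also have "\<dots> = (\<Sum>f\<in>{..<k} \<rightarrow>\<^sub>E {..<d}. \<Prod>j<k. x (f j)) - (\<Sum>f\<in>?C ` {..<d}. \<Prod>j<k. x (f j))"
    unfolding J_def using fin C_sub by (rule sum_diff)
  also have "(\<Sum>f\<in>{..<k} \<rightarrow>\<^sub>E {..<d}. \<Prod>j<k. x (f j)) = (\<Sum>i<d. x i) ^ k"
    by (subst prod_sum_PiE[symmetric]) auto
  also have "(\<Sum>f\<in>?C ` {..<d}. \<Prod>j<k. x (f j)) = (\<Sum>i<d. x i ^ k)"
    by (subst sum.reindex[OF C_inj]) simp
  finally show "(\<Sum>f\<in>J. \<Prod>i<d. x i ^ card {j. j < k \<and> f j = i}) = (\<Sum>i<d. x i) ^ k - (\<Sum>i<d. x i ^ k)" .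
  have "card J + card (?C ` {..<d}) = card ({..<k} \<rightarrow>\<^sub>E {..<d})"
    unfolding J_def using fin C_sub card_mono[OF fin C_sub] by (simp add: card_Diff_subset finite_subset)
  then have "card J + d = d ^ k"
    using C_inj by (simp add: card_image card_PiE)
  then have "real (card J + d) = real (d ^ k)" by (rule arg_cong)
  then show "real (card J) = real d ^ k - real d" by simp
qed

text \<open>Every exponent vector of a nonconstant assignment and every balanced vector has total
  \<open>k\<close>, so Muirhead's inequality holds between any two of them. Both families have a
  symmetric total, so symmetrising costs the common factor \<open>d!\<close> only.\<close>

lemma balanced_monomials_le:
  fixes x :: "nat \<Rightarrow> real"
  assumes x: "\<And>i. i < d \<Longrightarrow> x i \<ge> 0" and k: "k = d * s + b" "k \<ge> 1"
  shows "(real d ^ k - real d) * (\<Sum>B | B \<subseteq> {..<d} \<and> card B = b. \<Prod>i<d. x i ^ (s + of_bool (i \<in> B)))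
    \<le> real (d choose b) * ((\<Sum>i<d. x i) ^ k - (\<Sum>i<d. x i ^ k))"
proof -
  define J where "J = ({..<k} \<rightarrow>\<^sub>E {..<d}) - (\<lambda>i. \<lambda>j\<in>{..<k}. i) ` {..<d}"
  define a where "a f i = card {j. j < k \<and> f j = i}" for f :: "nat \<Rightarrow> nat" and i
  define \<B> where "\<B> = {B. B \<subseteq> {..<d} \<and> card B = b}"
  define e where "e B i = s + of_bool (i \<in> B)" for B :: "nat set" and i
  note J = nonconstant_functions_sum[OF k(2), where d = d, folded J_def a_def]
  have a_sum: "(\<Sum>i<d. a f i) = k" if "f \<in> J" for f
  proof -
    have "(\<Sum>i<d. a f i) = (\<Sum>i<d. \<Sum>j\<in>{j\<in>{..<k}. f j = i}. 1)" by (simp add: a_def)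
    also have "\<dots> = (\<Sum>j<k. 1)"
      using that by (intro sum.group) (auto simp: J_def)
    finally show ?thesis by simp
  qed
  have e_sum: "(\<Sum>i<d. e B i) = k" if "B \<in> \<B>" for B
  proof -
    have "{i \<in> {..<d}. i \<in> B} = B" using that by (auto simp: \<B>_def)
    then have "(\<Sum>i<d. of_bool (i \<in> B)) = card B"
      by (simp add: sum_of_bool_eq Int_def)
    then show ?thesis using that by (simp add: e_def sum.distrib k \<B>_def)
  qed
  have symB: "(\<Sum>B\<in>\<B>. symsum d x (e B)) = fact d * (\<Sum>B\<in>\<B>. \<Prod>i<d. x i ^ e B i)"
    unfolding e_def \<B>_def by (intro sum_symsum subset_monomials_symmetric)
  have symJ: "(\<Sum>f\<in>J. symsum d x (a f)) = fact d * (\<Sum>f\<in>J. \<Prod>i<d. x i ^ a f i)"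
  proof (rule sum_symsum)
    fix \<sigma> assume \<sigma>: "\<sigma> permutes {..<d}"
    have "(\<Sum>i<d. x (\<sigma> i)) = (\<Sum>i<d. x i)" "(\<Sum>i<d. x (\<sigma> i) ^ k) = (\<Sum>i<d. x i ^ k)"
      using sum.permute[OF \<sigma>, of x] sum.permute[OF \<sigma>, of "\<lambda>i. x i ^ k"] by (simp_all add: comp_def)
    then show "(\<Sum>f\<in>J. \<Prod>i<d. x (\<sigma> i) ^ a f i) = (\<Sum>f\<in>J. \<Prod>i<d. x i ^ a f i)"
      by (simp add: J(1))
  qed
  have "card \<B> = d choose b"
    using n_subsets[of "{..<d}" b] by (simp add: \<B>_def)
  \<comment> \<open>The comparison is summed over all pairs of an assignment \<open>f\<close> and a
    subset \<open>B\<close>, which produces the factors \<open>card J\<close> on the left and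
    \<open>card \<B>\<close> on the right.\<close>
  have "fact d * ((real d ^ k - real d) * (\<Sum>B\<in>\<B>. \<Prod>i<d. x i ^ e B i)) =
      (\<Sum>f\<in>J. \<Sum>B\<in>\<B>. symsum d x (e B))"
    by (simp add: symB J(2))
  also have "\<dots> \<le> (\<Sum>f\<in>J. \<Sum>B\<in>\<B>. symsum d x (a f))"
    using x by (intro sum_mono symsum_balanced_le) (auto simp: a_sum e_sum, auto simp: e_def)
  also have "\<dots> = fact d * (real (d choose b) * ((\<Sum>i<d. x i) ^ k - (\<Sum>i<d. x i ^ k)))"
    by (simp add: \<open>card \<B> = d choose b\<close> symJ J(1) flip: sum_distrib_left)
  finally show ?thesis
    by (simp add: \<B>_def e_def)
qed

section \<open>Shapes of induced trees\<close>

definition below :: "nat list set \<Rightarrow> nat \<Rightarrow> nat list set" where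
  "below S i = {p. i # p \<in> S}"

text \<open>The empty set is split off because \<open>prune {}\<close> still keeps the root and
  would be mistaken for a single leaf.\<close>

definition shape :: "rtree \<Rightarrow> nat list set \<Rightarrow> utree option" where
  "shape t S = (if S = {} then None else Some (canon (suppress (prune S t))))"

definition shape_count :: "rtree \<Rightarrow> utree option \<Rightarrow> nat" where
  "shape_count t v = card {S. S \<subseteq> leaves t \<and> shape t S = v}"

lemma in_below_iff [simp]: "p \<in> below S i \<longleftrightarrow> i # p \<in> S"
  by (simp add: below_def)

lemma shape_empty [simp]: "shape t {} = None"
  by (simp add: shape_def)

lemma shape_eq_None_iff [simp]: "shape t S = None \<longleftrightarrow> S = {}"
  by (simp add: shape_def)

lemma prune_Node:
  "prune S (Node ts) =
     Node (map (\<lambda>i. prune (below S i) (ts ! i)) (filter (\<lambda>i. below S i \<noteq> {}) [0..<length ts]))"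
  by (auto simp: below_def)

declare prune.simps [simp del]

lemma suppress_prune_single:
  assumes "{i. i < length ts \<and> below S i \<noteq> {}} = {i}"
  shows "suppress (prune S (Node ts)) = suppress (prune (below S i) (ts ! i))"
proof -
  let ?xs = "filter (\<lambda>i. below S i \<noteq> {}) [0..<length ts]"
  have "set ?xs = {i}" using assms by auto
  moreover from this have "length ?xs = 1"
    using distinct_card[of ?xs] by simp
  then obtain x where "?xs = [x]" by (auto simp: length_Suc_conv)
  ultimately have "?xs = [i]" by simp
  then show ?thesis by (simp add: prune_Node)
qed

lemma canon_suppress_prune_multi:
  assumes "card {i. i < length ts \<and> below S i \<noteq> {}} \<noteq> 1"
  shows "canon (suppress (prune S (Node ts))) =
    UNode (image_mset (\<lambda>i. canon (suppress (prune (below S i) (ts ! i))))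
      (mset_set {i. i < length ts \<and> below S i \<noteq> {}}))"
proof -
  let ?xs = "filter (\<lambda>i. below S i \<noteq> {}) [0..<length ts]"
  have set_xs: "set ?xs = {i. i < length ts \<and> below S i \<noteq> {}}" by auto
  have "length ?xs \<noteq> 1"
    using assms set_xs distinct_card[of ?xs] by simp
  \<comment> \<open>The case rule separates lists of length zero, one and at least two, following
    the case distinction in \<open>suppress\<close>.\<close>
  then have "suppress (prune S (Node ts)) = Node (map (\<lambda>i. suppress (prune (below S i) (ts ! i))) ?xs)"
    by (cases ?xs rule: remdups_adj.cases) (simp_all add: prune_Node comp_def)
  moreover have "mset ?xs = mset_set {i. i < length ts \<and> below S i \<noteq> {}}"
    using mset_set_set[of ?xs] set_xs by simp
  ultimately show ?thesis
    by (simp add: multiset.map_comp comp_def del: mset_filter)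
qed

lemma leaves_Node_decompose:
  assumes "S \<subseteq> leaves (Node ts)" "ts \<noteq> []"
  shows "S = (\<Union>i\<in>{i. i < length ts \<and> below S i \<noteq> {}}. (#) i ` below S i)"
proof (intro set_eqI)
  fix p
  show "p \<in> S \<longleftrightarrow> p \<in> (\<Union>i\<in>{i. i < length ts \<and> below S i \<noteq> {}}. (#) i ` below S i)"
  proof (cases p)
    case (Cons i q)
    then show ?thesis using assms by (auto intro!: exI[of _ i] imageI)
  qed (use assms in auto)
qed

lemma below_subset_leaves:
  "S \<subseteq> leaves (Node ts) \<Longrightarrow> below S i \<subseteq> leaves (ts ! i)"
  by auto

text \<open>Pruning keeps exactly the leaves in \<open>S\<close>, and suppression removes none of
  them. Hence the shape alone determines the size of \<open>S\<close>, and the cardinality condition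
  in \<open>copies\<close> follows from the shape condition.\<close>

lemma uleaves_suppress_prune:
  "S \<subseteq> leaves t \<Longrightarrow> S \<noteq> {} \<Longrightarrow> uleaves (canon (suppress (prune S t))) = card S"
proof (induction t arbitrary: S)
  case (Node ts)
  show ?case
  proof (cases "ts = []")
    case True
    then have "S = {[]}" using Node.prems by (auto simp: leaves_Node_Nil)
    then show ?thesis by (simp add: True prune_Node)
  next
    case False
    define I where "I = {i. i < length ts \<and> below S i \<noteq> {}}"
    have I: "finite I" "I \<noteq> {}"
      using leaves_Node_decompose[OF Node.prems(1) False] Node.prems(2) by (auto simp: I_def)
    have fin: "finite S"
      using finite_subset[OF Node.prems(1)] finite_leaves by blast
    have IH: "uleaves (canon (suppress (prune (below S i) (ts ! i)))) = card (below S i)" if "i \<in> I" for i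
      using that Node.IH[of "ts ! i" "below S i"] below_subset_leaves[OF Node.prems(1)]
      by (auto simp: I_def)
    have "card S = card (\<Union>i\<in>I. (#) i ` below S i)"
      using leaves_Node_decompose[OF Node.prems(1) False] by (simp add: I_def)
    also have "\<dots> = (\<Sum>i\<in>I. card ((#) i ` below S i))"
      using I finite_subset[OF below_subset_leaves[OF Node.prems(1)] finite_leaves]
      by (intro card_UN_disjoint) auto
    also have "\<dots> = (\<Sum>i\<in>I. card (below S i))" by (simp add: card_image)
    finally have card: "card S = (\<Sum>i\<in>I. card (below S i))" .
    show ?thesis
    proof (cases "card I = 1")
      case True
      then obtain i where i: "I = {i}" by (auto simp: card_1_singleton_iff)
      then have "suppress (prune S (Node ts)) = suppress (prune (below S i) (ts ! i))"
        by (intro suppress_prune_single) (simp add: I_def)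
      then show ?thesis using IH[of i] card i by simp
    next
      case False
      then have "canon (suppress (prune S (Node ts))) =
          UNode (image_mset (\<lambda>i. canon (suppress (prune (below S i) (ts ! i)))) (mset_set I))"
        unfolding I_def by (rule canon_suppress_prune_multi)
      then show ?thesis
        using I IH by (simp add: card mset_set_empty_iff multiset.map_comp comp_def flip: sum_unfold_sum_mset)
    qed
  qed
qed

text \<open>A vertex strictly above the most recent common ancestor has just one child after pruning
  and is suppressed, so starting at the root gives the same result. This removes the common ancestor
  from all later arguments.\<close>

lemma induced_tree_eq_suppress_prune:
  "S \<subseteq> leaves t \<Longrightarrow> S \<noteq> {} \<Longrightarrow> induced_tree t S = suppress (prune S t)"
proof (induction t arbitrary: S)
  case (Node ts)
  show ?case
  proof (cases "ts = []")
    case True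
    then have "S = {[]}" using Node.prems by (auto simp: leaves_Node_Nil)
    then show ?thesis
      by (simp add: induced_tree_def spanned_subtree_def Longest_common_prefix_Nil Let_def)
  next
    case False
    note dec = leaves_Node_decompose[OF Node.prems(1) False]
    have "{i. i < length ts \<and> below S i \<noteq> {}} \<noteq> {}"
      using dec Node.prems(2) by (metis UN_empty)
    then obtain i where i: "i < length ts" "below S i \<noteq> {}" by auto
    show ?thesis
    proof (cases "\<exists>j. j \<noteq> i \<and> below S j \<noteq> {}")
      case True
      then obtain j p q where "j \<noteq> i" "i # p \<in> S" "j # q \<in> S" using i by auto
      \<comment> \<open>Two different branches are met, so the common ancestor is the root
        itself.\<close>
      then have "Longest_common_prefix S = []" by (metis Longest_common_prefix_eq_Nil)
      then show ?thesis
        by (simp add: induced_tree_def spanned_subtree_def Let_def)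
    next
      case F: False
      then have I: "{i. i < length ts \<and> below S i \<noteq> {}} = {i}" using i by auto
      then have S: "S = (#) i ` below S i" using dec by simp
      have lcp: "Longest_common_prefix S = i # Longest_common_prefix (below S i)"
        by (subst S) (rule Longest_common_prefix_image_Cons[OF i(2)])
      have "induced_tree (Node ts) S = induced_tree (ts ! i) (below S i)"
        using i by (simp add: induced_tree_def spanned_subtree_def Let_def lcp)
      also have "\<dots> = suppress (prune (below S i) (ts ! i))"
        using i below_subset_leaves[OF Node.prems(1)] by (intro Node.IH) auto
      finally show ?thesis by (simp add: suppress_prune_single[OF I])
    qed
  qed
qed

lemma copies_eq_shape_count: "copies D t = shape_count t (Some (canon D))"
proof -
  have "S \<subseteq> leaves t \<and> card S = num_leaves D \<and> isomorphic (induced_tree t S) D \<longleftrightarrow>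
      S \<subseteq> leaves t \<and> shape t S = Some (canon D)" for S
  proof (cases "S \<subseteq> leaves t")
    case True
    show ?thesis
    proof (cases "S = {}")
      case True
      \<comment> \<open>The empty set is ruled out on the left by its size and on the right by the
        value \<open>None\<close>.\<close>
      have "num_leaves D \<noteq> 0"
      proof (induction D)
        case (Node ts)
        then show ?case by (cases "ts = []") (auto simp: num_leaves_Node_Nil num_leaves_Node)
      qed
      then show ?thesis using True by simp
    next
      case False
      then show ?thesis
        using True induced_tree_eq_suppress_prune[OF True False] uleaves_suppress_prune[OF True False]
        by (auto simp: shape_def isomorphic_iff_canon_eq num_leaves_eq_uleaves)
    qed
  qed simp
  then show ?thesis by (simp add: copies_def shape_count_def)
qed

text \<open>The value \<open>None\<close> at \<open>k = 0\<close> plays the role of the empty tree \<open>E\<^sub>0\<close>, which makes stars (\<open>s = 0\<close>) an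
  instance of the general splitting \<open>k = d s + b\<close>.\<close>

definition even_shape :: "nat \<Rightarrow> nat \<Rightarrow> utree option" where
  "even_shape d k = (if k = 0 then None else Some (canon (even_tree d k)))"

lemma even_shape_0 [simp]: "even_shape d 0 = None"
  by (simp add: even_shape_def)

lemma even_shape_eq_None_iff [simp]: "even_shape d k = None \<longleftrightarrow> k = 0"
  by (simp add: even_shape_def)

lemma even_tree_1: "even_tree d (Suc 0) = Node []"
  by (simp add: even_tree.simps)

lemma uleaves_even_tree:
  assumes "d \<ge> 2"
  shows "k \<ge> 1 \<Longrightarrow> uleaves (canon (even_tree d k)) = k"
proof (induction k rule: less_induct)
  case (less k)
  consider "k = 1" | "2 \<le> k" "k \<le> d" | "d < k" using less.prems by linarith
  then show ?case
  proof cases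
    case 3
    have "k div d \<ge> 1" "k div d < k" using 3 assms by (auto simp: div_greater_zero_iff Suc_le_eq)
    moreover have "k div d + 1 < k"
    proof -
      have "k div d \<le> k div 2" using assms by (intro div_le_mono2) auto
      moreover have "k div 2 + 1 < k" using 3 assms by presburger
      ultimately show ?thesis by linarith
    qed
    moreover have "(d - k mod d) * (k div d) + k mod d * (k div d + 1) = k"
    proof -
      have "k mod d \<le> d" using assms by (simp add: less_imp_le)
      then have "(d - k mod d) * (k div d) + k mod d * (k div d + 1) = d * (k div d) + k mod d"
        by (simp add: diff_mult_distrib algebra_simps)
      then show ?thesis by simp
    qed
    ultimately show ?thesis
      using less.IH[of "k div d"] less.IH[of "k div d + 1"] 3 assms by (simp add: even_tree.simps[of d k])
  qed (use assms in \<open>simp_all add: even_tree.simps[of d k] even_tree_1\<close>)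
qed

text \<open>Even trees are told apart by their numbers of leaves, and \<open>None\<close> accounts
  for zero leaves.\<close>

lemma even_shape_eq_iff:
  assumes "d \<ge> 2"
  shows "even_shape d k = even_shape d l \<longleftrightarrow> k = l"
proof
  assume eq: "even_shape d k = even_shape d l"
  show "k = l"
  proof (cases "k = 0 \<or> l = 0")
    case True
    then show ?thesis using eq by (metis even_shape_eq_None_iff)
  next
    case False
    then have "canon (even_tree d k) = canon (even_tree d l)" using eq by (simp add: even_shape_def)
    then have "uleaves (canon (even_tree d k)) = uleaves (canon (even_tree d l))" by (rule arg_cong)
    then show ?thesis using False assms by (simp add: uleaves_even_tree)
  qed
qed simp

section \<open>Splitting a copy of an even tree at the root\<close>

lemma filter_replicate_mset:
  "filter_mset P (replicate_mset n x) = (if P x then replicate_mset n x else {#})"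
  by (induction n) auto

text \<open>The star clause is also covered: \<open>k < d\<close> gives \<open>s = 0\<close> and
  \<open>b = k\<close>, with \<open>d - b\<close> empty branches filtered out, and
  \<open>k = d\<close> gives \<open>s = 1\<close> and \<open>b = 0\<close>.\<close>

lemma even_shape_canon:
  assumes "d \<ge> 2" "k = d * s + b" "b < d" "k \<ge> 2"
  shows "\<exists>M. even_shape d k = Some (UNode M) \<and> image_mset Some M =
    filter_mset (\<lambda>v. v \<noteq> None)
      (replicate_mset (d - b) (even_shape d s) + replicate_mset b (even_shape d (s + 1)))"
proof -
  have sb: "k div d = s" "k mod d = b" using assms by auto
  consider "k < d" | "k = d" | "k > d" by linarith
  then show ?thesis
  proof cases
    case 1
    then have "s = 0" "b = k" using sb by auto
    then show ?thesis using 1 assms(4)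
      by (simp add: even_shape_def even_tree.simps[of d k] even_tree_1 image_replicate_mset filter_replicate_mset)
  next
    case 2
    then have "s = 1" "b = 0" using sb assms by auto
    then show ?thesis using 2 assms(4)
      by (simp add: even_shape_def even_tree.simps[of d d] even_tree_1 image_replicate_mset filter_replicate_mset)
  next
    case 3
    have "s > 0" using 3 assms by (cases "s = 0") auto
    then show ?thesis using 3 assms(1,4)
      by (simp add: even_shape_def even_tree.simps[of d k] sb image_replicate_mset filter_replicate_mset)
  qed
qed

text \<open>Takes \<open>B\<close> to be the fibre of \<open>F\<close> over \<open>v\<close>. It
  turns an equality of multisets of branches into a choice of the branches that carry the larger
  even tree; \<open>u \<noteq> v\<close> makes the multiplicity of \<open>v\<close> equal to
  \<open>b\<close>.\<close>

lemma image_replicate_mset_iff: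
  assumes "u \<noteq> v" "b \<le> d"
  shows "image_mset F (mset_set {..<d}) = replicate_mset (d - b) u + replicate_mset b v \<longleftrightarrow>
    (\<exists>B\<subseteq>{..<d}. card B = b \<and> (\<forall>i<d. F i = (if i \<in> B then v else u)))"
proof
  assume eq: "image_mset F (mset_set {..<d}) = replicate_mset (d - b) u + replicate_mset b v"
  define B where "B = {i\<in>{..<d}. F i = v}"
  have "F i = (if i \<in> B then v else u)" if "i < d" for i
  proof -
    have "F i \<in># image_mset F (mset_set {..<d})" using that by simp
    then show ?thesis using that by (auto simp: eq B_def split: if_splits)
  qed
  moreover have "card B = b"
  proof -
    have "count (image_mset F (mset_set {..<d})) v = card B"
      by (simp add: count_image_mset B_def vimage_def Int_def conj_commute)
    then show ?thesis using assms by (simp add: eq)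
  qed
  moreover have "B \<subseteq> {..<d}" by (auto simp: B_def)
  ultimately show "\<exists>B\<subseteq>{..<d}. card B = b \<and> (\<forall>i<d. F i = (if i \<in> B then v else u))" by blast
next
  assume "\<exists>B\<subseteq>{..<d}. card B = b \<and> (\<forall>i<d. F i = (if i \<in> B then v else u))"
  then obtain B where B: "B \<subseteq> {..<d}" "card B = b" and F: "\<forall>i<d. F i = (if i \<in> B then v else u)"
    by blast
  have fin: "finite B" using B finite_subset by blast
  have "mset_set {..<d} = mset_set ({..<d} - B) + mset_set B"
    using B fin by (subst mset_set_Union[symmetric]) (auto intro: arg_cong[of _ _ mset_set])
  moreover have "image_mset F (mset_set ({..<d} - B)) = image_mset (\<lambda>_. u) (mset_set ({..<d} - B))"
    using F by (intro image_mset_cong) auto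
  moreover have "image_mset F (mset_set B) = image_mset (\<lambda>_. v) (mset_set B)"
    using F B fin by (intro image_mset_cong) auto
  ultimately show "image_mset F (mset_set {..<d}) = replicate_mset (d - b) u + replicate_mset b v"
    using B fin by (simp add: image_mset_const_eq card_Diff_subset)
qed

text \<open>The number of deleted copies of \<open>a\<close> can be recovered from the size.\<close>

lemma filter_mset_neq_eq_iff:
  assumes "size X = size Y"
  shows "filter_mset (\<lambda>v. v \<noteq> a) X = filter_mset (\<lambda>v. v \<noteq> a) Y \<longleftrightarrow> X = Y"
proof
  assume eq: "filter_mset (\<lambda>v. v \<noteq> a) X = filter_mset (\<lambda>v. v \<noteq> a) Y"
  have part: "Z = filter_mset (\<lambda>v. v \<noteq> a) Z + replicate_mset (size Z - size (filter_mset (\<lambda>v. v \<noteq> a) Z)) a" for Z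
  proof -
    have 1: "Z = filter_mset (\<lambda>v. v \<noteq> a) Z + filter_mset (\<lambda>v. \<not> v \<noteq> a) Z"
      by (rule multiset_partition)
    have 2: "filter_mset (\<lambda>v. \<not> v \<noteq> a) Z = replicate_mset (count Z a) a"
      using filter_eq_replicate_mset[of a Z] by (simp add: eq_commute)
    have "size Z = size (filter_mset (\<lambda>v. v \<noteq> a) Z) + count Z a"
      using arg_cong[OF 1, of size] unfolding size_union 2 by simp
    then have "size Z - size (filter_mset (\<lambda>v. v \<noteq> a) Z) = count Z a" by simp
    then show ?thesis using 1 unfolding 2 by (rule ssubst)
  qed
  show "X = Y"
    using part[of X] part[of Y] assms eq by metis
qed simp

text \<open>For \<open>s = 0\<close> the subset \<open>B\<close> has at least two elements;
  otherwise all \<open>d \<ge> 2\<close> branches are nonempty. Thus a copy split at the root is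
  never confused with a copy inside one branch.\<close>

lemma even_split_two_nonzero:
  fixes d s b :: nat
  assumes "d \<ge> 2" "d * s + b \<ge> 2" "B \<subseteq> {..<d}" "card B = b"
  shows "\<exists>i j. i < d \<and> j < d \<and> i \<noteq> j \<and> (if i \<in> B then s + 1 else s) \<noteq> 0 \<and> (if j \<in> B then s + 1 else s) \<noteq> 0"
proof (cases "s = 0")
  case True
  then have "card B \<ge> 2" using assms by simp
  then obtain C where "C \<subseteq> B" "card C = 2" by (meson obtain_subset_with_card_n)
  then obtain i j where "i \<in> B" "j \<in> B" "i \<noteq> j" by (auto simp: card_2_iff)
  then show ?thesis using assms(3) by (intro exI[of _ i] exI[of _ j]) auto
next
  case False
  then show ?thesis using assms(1) by (intro exI[of _ 0] exI[of _ 1]) auto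
qed

text \<open>If \<open>S\<close> meets exactly one branch, the root is suppressed and the shape is
  that of the branch. Otherwise the root survives, and its multiset of branch shapes, padded to size
  \<open>d\<close>, is compared with that of the even tree.\<close>

lemma shape_eq_even_shape_iff:
  assumes d: "d \<ge> 2" and k: "k = d * s + b" "b < d" "k \<ge> 2"
    and ts: "ts \<noteq> []" "length ts \<le> d" and S: "S \<subseteq> leaves (Node ts)"
  shows "shape (Node ts) S = even_shape d k \<longleftrightarrow>
    (\<exists>i<d. (\<forall>j. j \<noteq> i \<longrightarrow> below S j = {}) \<and> shape (ts ! i) (below S i) = even_shape d k) \<or>
    (\<exists>B\<subseteq>{..<d}. card B = b \<and>
      (\<forall>i<d. shape (ts ! i) (below S i) = even_shape d (if i \<in> B then s + 1 else s)))"
    (is "_ \<longleftrightarrow> ?one \<or> ?many")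
proof -
  define F where "F i = shape (ts ! i) (below S i)" for i
  define I where "I = {i. i < length ts \<and> below S i \<noteq> {}}"
  have belowD: "i < length ts" if "below S i \<noteq> {}" for i
    using that S by auto
  have I_iff: "i \<in> I \<longleftrightarrow> F i \<noteq> None" for i
    using belowD by (auto simp: I_def F_def)
  have "i < d" if "i \<in> I" for i
    using that ts(2) by (simp add: I_def)
  then have I_d: "I = {i\<in>{..<d}. F i \<noteq> None}"
    using I_iff by auto
  have S_empty: "S = {} \<longleftrightarrow> I = {}"
    using leaves_Node_decompose[OF S ts(1)] by (auto simp: I_def)
  have many_two: "\<exists>i j. i \<in> I \<and> j \<in> I \<and> i \<noteq> j" if ?many
  proof -
    from that obtain B where B: "B \<subseteq> {..<d}" "card B = b"
        "\<forall>i<d. F i = even_shape d (if i \<in> B then s + 1 else s)"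
      unfolding F_def by blast
    obtain i j where "i < d \<and> j < d \<and> i \<noteq> j \<and> (if i \<in> B then s + 1 else s) \<noteq> 0 \<and> (if j \<in> B then s + 1 else s) \<noteq> 0"
      using even_split_two_nonzero[OF d k(3)[unfolded k(1)] B(1,2)] by blast
    then show ?thesis using B(3) unfolding I_iff
      by (intro exI[of _ i] exI[of _ j]) (simp split: if_splits)
  qed
  have one_I: "\<exists>i. I = {i}" if ?one
  proof -
    from that obtain i where i: "\<forall>j. j \<noteq> i \<longrightarrow> below S j = {}" "F i = even_shape d k" unfolding F_def by blast
    then have "F i \<noteq> None" using k(3) by simp
    then have "i \<in> I" by (simp add: I_iff)
    moreover have "j = i" if "j \<in> I" for j using that i(1) by (auto simp: I_def)
    ultimately show ?thesis by auto
  qed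
  show ?thesis
  proof (cases "\<exists>i. I = {i}")
    case True
    then obtain i where i: "I = {i}" by blast
    have not_many: "\<not> ?many"
    proof
      assume ?many
      from many_two[OF this] show False unfolding i by blast
    qed
    have "S \<noteq> {}" using S_empty i by simp
    have "i \<in> I" using i by simp
    then have "below S i \<noteq> {}" by (simp add: I_def)
    have eq: "shape (Node ts) S = F i"
      using suppress_prune_single[OF i[unfolded I_def]] \<open>S \<noteq> {}\<close> \<open>below S i \<noteq> {}\<close>
      by (simp add: F_def shape_def)
    have "i < d" using \<open>i \<in> I\<close> I_d by simp
    have "below S j = {}" if "j \<noteq> i" for j
    proof (rule ccontr)
      assume "below S j \<noteq> {}"
      then have "j \<in> I" using belowD by (simp add: I_def)
      then show False using that i by simp
    qed
    with \<open>i < d\<close> have "?one" if "F i = even_shape d k"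
      using that unfolding F_def by blast
    moreover have "F i = even_shape d k" if ?one
    proof -
      from that obtain j where j: "\<forall>l. l \<noteq> j \<longrightarrow> below S l = {}" "F j = even_shape d k" unfolding F_def by blast
      with \<open>below S i \<noteq> {}\<close> have "j = i" by metis
      with j show ?thesis by simp
    qed
    ultimately have one: "?one \<longleftrightarrow> F i = even_shape d k" by blast
    show ?thesis by (simp only: eq one not_many simp_thms)
  next
    case False
    have not_one: "\<not> ?one"
    proof
      assume ?one
      from one_I[OF this] show False using False by blast
    qed
    have "shape (Node ts) S = even_shape d k \<longleftrightarrow> ?many"
    proof (cases "S = {}")
      case True
      then have "I = {}" using S_empty by simp
      have "\<not> ?many"
      proof
        assume ?many
        from many_two[OF this] show False unfolding \<open>I = {}\<close> by blast
      qed
      moreover have "shape (Node ts) S \<noteq> even_shape d k"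
        using True k(3) even_shape_eq_None_iff[of d k] by (metis not_numeral_le_zero shape_empty)
      ultimately show ?thesis by blast
    next
      case S_ne: False
      have "card I \<noteq> 1" using False by (simp add: card_1_singleton_iff)
      have sh: "shape (Node ts) S = Some (UNode (image_mset (the \<circ> F) (mset_set I)))"
      proof -
        have "image_mset (\<lambda>i. canon (suppress (prune (below S i) (ts ! i)))) (mset_set I) =
            image_mset (the \<circ> F) (mset_set I)"
          by (intro image_mset_cong) (auto simp: F_def shape_def I_def)
        with canon_suppress_prune_multi[OF \<open>card I \<noteq> 1\<close>[unfolded I_def]] S_ne show ?thesis
          by (simp only: shape_def if_False flip: I_def)
      qed
      obtain M where M: "even_shape d k = Some (UNode M)" "image_mset Some M =
          filter_mset (\<lambda>v. v \<noteq> None)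
            (replicate_mset (d - b) (even_shape d s) + replicate_mset b (even_shape d (s + 1)))"
        using even_shape_canon[OF d k] by blast
      have "image_mset Some (image_mset (the \<circ> F) (mset_set I)) = image_mset F (mset_set I)"
        unfolding multiset.map_comp using I_d by (intro image_mset_cong) auto
      also have "\<dots> = filter_mset (\<lambda>v. v \<noteq> None) (image_mset F (mset_set {..<d}))"
        by (simp add: filter_mset_image_mset I_d)
      finally have F: "image_mset Some (image_mset (the \<circ> F) (mset_set I)) =
        filter_mset (\<lambda>v. v \<noteq> None) (image_mset F (mset_set {..<d}))" .
      have "shape (Node ts) S = even_shape d k \<longleftrightarrow> image_mset (the \<circ> F) (mset_set I) = M"
        by (simp add: sh M(1))
      also have "\<dots> \<longleftrightarrow> image_mset Some (image_mset (the \<circ> F) (mset_set I)) = image_mset Some M"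
        by (rule inj_eq[OF multiset.inj_map[OF inj_Some], symmetric])
      \<comment> \<open>Both padded multisets have \<open>d\<close> elements, so the empty branches
        filtered out on either side can be restored.\<close>
      also have "\<dots> \<longleftrightarrow> image_mset F (mset_set {..<d}) =
          replicate_mset (d - b) (even_shape d s) + replicate_mset b (even_shape d (s + 1))"
        unfolding F M(2) using k(2) by (intro filter_mset_neq_eq_iff) simp
      also have "\<dots> \<longleftrightarrow> (\<exists>B\<subseteq>{..<d}. card B = b \<and>
          (\<forall>i<d. F i = (if i \<in> B then even_shape d (s + 1) else even_shape d s)))"
        using k(2) even_shape_eq_iff[OF d] by (intro image_replicate_mset_iff) auto
      also have "\<dots> \<longleftrightarrow> ?many"
        by (simp only: F_def if_distrib[of "even_shape d"])
      finally show ?thesis .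
    qed
    then show ?thesis by (simp only: not_one simp_thms)
  qed
qed

section \<open>The recursion at the root\<close>

text \<open>Beyond \<open>length ts\<close> the branches are empty; \<open>ts ! i\<close> is then unspecified, but harmless since
  \<open>shape\<close> ignores the tree on the empty set.\<close>

definition branch_leaves :: "rtree list \<Rightarrow> nat \<Rightarrow> nat list set" where
  "branch_leaves ts i = (if i < length ts then leaves (ts ! i) else {})"

definition branch_count :: "rtree list \<Rightarrow> nat \<Rightarrow> utree option \<Rightarrow> nat" where
  "branch_count ts i v = card {R. R \<subseteq> branch_leaves ts i \<and> shape (ts ! i) R = v}"

lemma branch_count_inside: "i < length ts \<Longrightarrow> branch_count ts i v = shape_count (ts ! i) v"
  by (simp add: branch_count_def shape_count_def branch_leaves_def)

lemma branch_count_outside: "\<not> i < length ts \<Longrightarrow> branch_count ts i v = of_bool (v = None)"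
proof -
  assume "\<not> i < length ts"
  then have "{R. R \<subseteq> branch_leaves ts i \<and> shape (ts ! i) R = v} = (if v = None then {{}} else {})"
    by (auto simp: branch_leaves_def)
  then show ?thesis by (simp add: branch_count_def)
qed

lemma below_subset_branch_leaves:
  "S \<subseteq> leaves (Node ts) \<Longrightarrow> below S i \<subseteq> branch_leaves ts i"
  by (auto simp: branch_leaves_def)

lemma shape_count_None: "shape_count t None = 1"
proof -
  have "{S. S \<subseteq> leaves t \<and> shape t S = None} = {{}}" by auto
  then show ?thesis by (simp add: shape_count_def)
qed

lemma suppress_prune_singleton: "p \<in> leaves t \<Longrightarrow> suppress (prune {p} t) = Node []"
proof (induction t arbitrary: p)
  case (Node ts)
  show ?case
  proof (cases p)
    case Nil
    then show ?thesis using Node.prems by (simp add: prune_Node)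
  next
    case (Cons i q)
    then have i: "i < length ts" "q \<in> leaves (ts ! i)" using Node.prems by auto
    have "below {p} j = (if j = i then {q} else {})" for j using Cons by auto
    then have "suppress (prune {p} (Node ts)) = suppress (prune (below {p} i) (ts ! i))"
      using i by (intro suppress_prune_single) auto
    moreover have "below {p} i = {q}" using Cons by auto
    ultimately show ?thesis using Node.IH i by simp
  qed
qed

lemma shape_count_even_shape_1: "shape_count t (even_shape d 1) = num_leaves t"
proof -
  have "{S. S \<subseteq> leaves t \<and> shape t S = even_shape d 1} = (\<lambda>p. {p}) ` leaves t"
  proof (intro equalityI subsetI)
    fix S assume "S \<in> {S. S \<subseteq> leaves t \<and> shape t S = even_shape d 1}"
    then have S: "S \<subseteq> leaves t" "S \<noteq> {}" "canon (suppress (prune S t)) = canon (Node [])"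
      by (auto simp: shape_def even_shape_def even_tree_1 split: if_splits)
    then have "card S = 1" using uleaves_suppress_prune[OF S(1,2)] by simp
    then show "S \<in> (\<lambda>p. {p}) ` leaves t" using S(1) by (auto simp: card_1_singleton_iff)
  next
    fix S assume "S \<in> (\<lambda>p. {p}) ` leaves t"
    then show "S \<in> {S. S \<subseteq> leaves t \<and> shape t S = even_shape d 1}"
      by (auto simp: shape_def even_shape_def even_tree_1 suppress_prune_singleton)
  qed
  then show ?thesis by (simp add: shape_count_def num_leaves_def card_image)
qed

lemma shape_count_leaf:
  assumes "d \<ge> 2" "k \<ge> 2"
  shows "shape_count (Node []) (even_shape d k) = 0"
proof -
  have "shape (Node []) S \<noteq> even_shape d k" if "S \<subseteq> leaves (Node [])" for S
  proof
    assume eq: "shape (Node []) S = even_shape d k"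
    then have "S \<noteq> {}"
      using assms(2) even_shape_eq_None_iff[of d k] by (metis not_numeral_le_zero shape_empty)
    then have "card S = k"
      using eq uleaves_suppress_prune[OF that] uleaves_even_tree[OF assms(1), of k] assms(2)
      by (simp add: shape_def even_shape_def split: if_splits)
    moreover have "card S \<le> 1"
      using card_mono[OF _ that] by (simp add: leaves_Node_Nil)
    ultimately show False using assms(2) by simp
  qed
  then have "{S. S \<subseteq> leaves (Node []) \<and> shape (Node []) S = even_shape d k} = {}" by blast
  then show ?thesis by (simp only: shape_count_def card.empty)
qed

text \<open>Restricting to branch \<open>i\<close> and prefixing addresses with \<open>i\<close> are
  mutually inverse between the two families of sets.\<close>

lemma card_single_branch:
  assumes v: "v \<noteq> None"
  shows "card {S. S \<subseteq> leaves (Node ts) \<and> (\<forall>j. j \<noteq> i \<longrightarrow> below S j = {}) \<and> shape (ts ! i) (below S i) = v} =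
    branch_count ts i v" (is "card ?A = _")
  unfolding branch_count_def
proof (rule bij_betw_same_card)
  show "bij_betw (\<lambda>S. below S i) ?A {R. R \<subseteq> branch_leaves ts i \<and> shape (ts ! i) R = v}"
  proof (rule bij_betw_byWitness[where f' = "(`) ((#) i)"])
    show "\<forall>S\<in>?A. (#) i ` below S i = S"
    proof
      fix S assume S: "S \<in> ?A"
      show "(#) i ` below S i = S"
      proof (intro set_eqI)
        fix p
        show "p \<in> (#) i ` below S i \<longleftrightarrow> p \<in> S"
        proof (cases p)
          case Nil
          \<comment> \<open>The empty address would be a leaf only if there were no children, but a
            shape other than \<open>None\<close> puts a leaf into branch \<open>i\<close>.\<close>
          have "below S i \<noteq> {}" using S v by auto
          then have "ts \<noteq> []" using S by auto
          then show ?thesis using Nil S by auto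
        next
          case (Cons j q)
          have "j = i" if "p \<in> S"
          proof (rule ccontr)
            assume "j \<noteq> i"
            then have "below S j = {}" using S by blast
            moreover have "q \<in> below S j" using that Cons by simp
            ultimately show False by blast
          qed
          then show ?thesis using Cons by auto
        qed
      qed
    qed
    have below: "below ((#) i ` R) j = (if j = i then R else {})" for R j by auto
    then show "\<forall>R\<in>{R. R \<subseteq> branch_leaves ts i \<and> shape (ts ! i) R = v}. below ((#) i ` R) i = R"
      by simp
    show "(\<lambda>S. below S i) ` ?A \<subseteq> {R. R \<subseteq> branch_leaves ts i \<and> shape (ts ! i) R = v}"
      using below_subset_branch_leaves by auto
    show "(`) ((#) i) ` {R. R \<subseteq> branch_leaves ts i \<and> shape (ts ! i) R = v} \<subseteq> ?A"
    proof
      fix S assume "S \<in> (`) ((#) i) ` {R. R \<subseteq> branch_leaves ts i \<and> shape (ts ! i) R = v}"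
      then obtain R where R: "R \<subseteq> branch_leaves ts i" "shape (ts ! i) R = v" "S = (#) i ` R" by auto
      then have "S \<subseteq> leaves (Node ts)" by (auto simp: branch_leaves_def split: if_splits)
      then show "S \<in> ?A" using R below by simp
    qed
  qed
qed

text \<open>A leaf set is the same as an independent choice of its traces in the \<open>d\<close>
  padded branches, which gives the product.\<close>

lemma card_all_branches:
  assumes ts: "ts \<noteq> []" "length ts \<le> d"
  shows "card {S. S \<subseteq> leaves (Node ts) \<and> (\<forall>i<d. shape (ts ! i) (below S i) = v i)} =
    (\<Prod>i<d. branch_count ts i (v i))" (is "card ?A = _")
proof -
  let ?G = "\<Pi>\<^sub>E i\<in>{..<d}. {R. R \<subseteq> branch_leaves ts i \<and> shape (ts ! i) R = v i}"
  let ?join = "\<lambda>g. {p. \<exists>i q. p = i # q \<and> i < d \<and> q \<in> g i}"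
  have "card ?A = card ?G"
  proof (rule bij_betw_same_card)
    show "bij_betw (\<lambda>S. \<lambda>i\<in>{..<d}. below S i) ?A ?G"
    proof (rule bij_betw_byWitness[where f' = ?join])
      show "\<forall>S\<in>?A. ?join (\<lambda>i\<in>{..<d}. below S i) = S"
      proof
        fix S assume S: "S \<in> ?A"
        show "?join (\<lambda>i\<in>{..<d}. below S i) = S"
        proof (intro set_eqI)
          fix p
          show "p \<in> ?join (\<lambda>i\<in>{..<d}. below S i) \<longleftrightarrow> p \<in> S"
          proof (cases p)
            case Nil
            then show ?thesis using S ts(1) by auto
          next
            case (Cons i q)
            have "i < d" if "p \<in> S"
            proof -
              have "i # q \<in> leaves (Node ts)" using S that Cons by auto
              then show ?thesis using ts(2) by simp
            qed
            then show ?thesis using Cons by auto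
          qed
        qed
      qed
      have below: "below (?join g) i = (if i < d then g i else {})" for g i by auto
      show "\<forall>g\<in>?G. (\<lambda>i\<in>{..<d}. below (?join g) i) = g"
      proof
        fix g assume "g \<in> ?G"
        then have "restrict g {..<d} = g" by (rule PiE_restrict)
        moreover have "(\<lambda>i\<in>{..<d}. below (?join g) i) = restrict g {..<d}"
          by (rule restrict_ext) (simp only: below lessThan_iff if_True)
        ultimately show "(\<lambda>i\<in>{..<d}. below (?join g) i) = g" by simp
      qed
      show "(\<lambda>S. \<lambda>i\<in>{..<d}. below S i) ` ?A \<subseteq> ?G"
      proof
        fix g assume "g \<in> (\<lambda>S. \<lambda>i\<in>{..<d}. below S i) ` ?A"
        then obtain S where S: "S \<in> ?A" "g = (\<lambda>i\<in>{..<d}. below S i)" by auto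
        then show "g \<in> ?G"
          using below_subset_branch_leaves[of S ts] by (simp add: restrict_PiE_iff)
      qed
      show "?join ` ?G \<subseteq> ?A"
      proof
        fix S assume "S \<in> ?join ` ?G"
        then obtain g where g: "g \<in> ?G" "S = ?join g" by auto
        have gi: "g i \<subseteq> branch_leaves ts i" "shape (ts ! i) (g i) = v i" if "i < d" for i
          using PiE_mem[OF g(1), of i] that by auto
        have "S \<subseteq> leaves (Node ts)"
        proof
          fix p assume "p \<in> S"
          then obtain i q where p: "p = i # q" "i < d" "q \<in> g i" using g by auto
          then have "q \<in> branch_leaves ts i" using gi by blast
          then show "p \<in> leaves (Node ts)" using p by (simp add: branch_leaves_def split: if_splits)
        qed
        moreover have "shape (ts ! i) (below S i) = v i" if "i < d" for i
          using gi(2)[OF that] that by (simp add: g(2) below)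
        ultimately show "S \<in> ?A" by simp
      qed
    qed
  qed
  also have "\<dots> = (\<Prod>i<d. branch_count ts i (v i))"
    by (simp add: card_PiE branch_count_def)
  finally show ?thesis .
qed

text \<open>The characterisation at the root splits the sets counted into the families
  \<open>A i\<close> and \<open>C B\<close>. They are disjoint: the branch met determines
  \<open>i\<close>, the branch shapes determine \<open>B\<close>, and a set in \<open>C B\<close>
  meets two branches.\<close>

lemma shape_count_Node:
  assumes d: "d \<ge> 2" and k: "k = d * s + b" "b < d" "k \<ge> 2"
    and ts: "ts \<noteq> []" "length ts \<le> d"
  shows "shape_count (Node ts) (even_shape d k) =
    (\<Sum>i<d. branch_count ts i (even_shape d k)) +
    (\<Sum>B | B \<subseteq> {..<d} \<and> card B = b.
       \<Prod>i<d. branch_count ts i (even_shape d (if i \<in> B then s + 1 else s)))"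
proof -
  let ?e = "\<lambda>B i. even_shape d (if i \<in> B then s + 1 else s)"
  define A where "A i = {S. S \<subseteq> leaves (Node ts) \<and> (\<forall>j. j \<noteq> i \<longrightarrow> below S j = {}) \<and>
    shape (ts ! i) (below S i) = even_shape d k}" for i
  define C where "C B = {S. S \<subseteq> leaves (Node ts) \<and> (\<forall>i<d. shape (ts ! i) (below S i) = ?e B i)}" for B
  define \<B> where "\<B> = {B. B \<subseteq> {..<d} \<and> card B = b}"
  have k_None: "even_shape d k \<noteq> None" using k(3) by simp
  have fin_leaves: "finite (Pow (leaves (Node ts)))" by (simp add: finite_leaves)
  have fin: "finite (A i)" "finite (C B)" for i B
    by (auto simp: A_def C_def intro: finite_subset[OF _ fin_leaves])
  have fin_B: "finite \<B>"
    by (rule finite_subset[of _ "Pow {..<d}"]) (auto simp: \<B>_def)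
  have A_ne: "below S i \<noteq> {}" if "S \<in> A i" for S i
  proof
    assume "below S i = {}"
    then show False using that k_None by (simp add: A_def)
  qed
  have A_disj: "A i \<inter> A j = {}" if "i \<noteq> j" for i j
  proof (rule ccontr)
    assume "A i \<inter> A j \<noteq> {}"
    then obtain S where "S \<in> A i" "S \<in> A j" by blast
    then show False using A_ne[of S i] that by (simp add: A_def)
  qed
  have C_disj: "C B \<inter> C B' = {}" if B: "B \<in> \<B>" "B' \<in> \<B>" "B \<noteq> B'" for B B'
  proof (rule ccontr)
    assume "C B \<inter> C B' \<noteq> {}"
    then obtain S where "S \<in> C B" "S \<in> C B'" by blast
    \<comment> \<open>Each branch shape reveals whether its index is \<open>s\<close> or
      \<open>s + 1\<close>, hence membership in \<open>B\<close>.\<close>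
    then have "even_shape d (if i \<in> B then s + 1 else s) = even_shape d (if i \<in> B' then s + 1 else s)"
      if "i < d" for i using that unfolding C_def by simp
    then have "i \<in> B \<longleftrightarrow> i \<in> B'" if "i < d" for i
      using that unfolding even_shape_eq_iff[OF d] by (metis add_cancel_right_right one_neq_zero)
    then show False using B by (auto simp: \<B>_def)
  qed
  have AC_disj: "A i \<inter> C B = {}" if B: "B \<in> \<B>" for i B
  proof (rule ccontr)
    assume "A i \<inter> C B \<noteq> {}"
    then obtain S where S: "S \<in> A i" "S \<in> C B" by blast
    obtain j l where "j < d" "l < d" "j \<noteq> l" "(if j \<in> B then s + 1 else s) \<noteq> 0" "(if l \<in> B then s + 1 else s) \<noteq> 0"
      using even_split_two_nonzero[OF d k(3)[unfolded k(1)], of B] B unfolding \<B>_def by blast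
    then have "?e B j \<noteq> None" "?e B l \<noteq> None" "shape (ts ! j) (below S j) = ?e B j"
        "shape (ts ! l) (below S l) = ?e B l"
      using S(2) unfolding C_def even_shape_eq_None_iff by blast+
    then have "below S j \<noteq> {}" "below S l \<noteq> {}" by (metis shape_empty)+
    then have "j = i" "l = i" using S(1) unfolding A_def mem_Collect_eq by metis+
    then show False using \<open>j \<noteq> l\<close> by simp
  qed
  have "{S. S \<subseteq> leaves (Node ts) \<and> shape (Node ts) S = even_shape d k} = (\<Union>i<d. A i) \<union> (\<Union>B\<in>\<B>. C B)"
  proof (intro set_eqI)
    fix S
    show "S \<in> {S. S \<subseteq> leaves (Node ts) \<and> shape (Node ts) S = even_shape d k} \<longleftrightarrow>
      S \<in> (\<Union>i<d. A i) \<union> (\<Union>B\<in>\<B>. C B)"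
    proof (cases "S \<subseteq> leaves (Node ts)")
      case True
      then show ?thesis
        using shape_eq_even_shape_iff[OF d k ts True] unfolding A_def C_def \<B>_def by blast
    qed (auto simp: A_def C_def)
  qed
  then have "shape_count (Node ts) (even_shape d k) = card ((\<Union>i<d. A i) \<union> (\<Union>B\<in>\<B>. C B))"
    by (simp add: shape_count_def)
  also have "\<dots> = card (\<Union>i<d. A i) + card (\<Union>B\<in>\<B>. C B)"
  proof (rule card_Un_disjoint)
    show "(\<Union>i<d. A i) \<inter> (\<Union>B\<in>\<B>. C B) = {}" using AC_disj by blast
  qed (use fin fin_B in auto)
  also have "card (\<Union>i<d. A i) = (\<Sum>i<d. card (A i))"
    using fin A_disj by (intro card_UN_disjoint) auto
  also have "card (\<Union>B\<in>\<B>. C B) = (\<Sum>B\<in>\<B>. card (C B))"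
    using fin fin_B C_disj by (intro card_UN_disjoint) auto
  finally show ?thesis
    by (simp add: A_def C_def card_single_branch[OF k_None] card_all_branches[OF ts] \<B>_def)
qed

lemma prod_if_mem:
  fixes u v :: "'a :: comm_monoid_mult"
  assumes "B \<subseteq> {..<d}"
  shows "(\<Prod>i<d. if i \<in> B then u else v) = v ^ (d - card B) * u ^ card B"
proof -
  have "finite B" using assms finite_subset by blast
  have "{..<d} \<inter> {i. i \<in> B} = B" "{..<d} \<inter> - {i. i \<in> B} = {..<d} - B" using assms by auto
  then show ?thesis
    using assms \<open>finite B\<close> by (simp add: prod.If_cases card_Diff_subset mult.commute)
qed

section \<open>Upper and lower bounds\<close>

lemma power_diff_self_pos:
  fixes d k :: nat
  assumes "d \<ge> 2" "k \<ge> 2"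
  shows "real d ^ k - real d > 0"
proof -
  have "real d ^ 1 < real d ^ k" using assms by (intro power_strict_increasing) auto
  then show ?thesis by simp
qed

locale even_tree_constants =
  fixes d :: nat and c :: "nat \<Rightarrow> real"
  assumes d: "d \<ge> 2"
    and c0: "c 0 = 1" and c1: "c 1 = 1"
    and c_rec: "\<And>s b. b < d \<Longrightarrow> d * s + b \<ge> 2 \<Longrightarrow>
           c (d * s + b) =
             real (d choose b) * (c s ^ (d - b) * c (s + 1) ^ b / (real d ^ (d * s + b) - real d))"
begin

text \<open>The recursion descends to \<open>s\<close>, and to \<open>s + 1\<close> when
  \<open>b \<noteq> 0\<close>. For \<open>b = 0\<close> the index \<open>s + 1\<close> may equal
  \<open>k\<close>, as for \<open>d = k = 2\<close>, but then the factor with exponent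
  \<open>b\<close> is 1; later proofs split on \<open>b = 0\<close> for this reason.\<close>

lemma split_less:
  assumes "b < d" "d * s + b \<ge> 2"
  shows "s < d * s + b" "b \<noteq> 0 \<Longrightarrow> s + 1 < d * s + b"
proof -
  have "2 * s \<le> d * s" using d by (intro mult_right_mono) auto
  then show "s < d * s + b" "b \<noteq> 0 \<Longrightarrow> s + 1 < d * s + b" using assms(2) by linarith+
qed

lemma obtain_split:
  obtains s b where "k = d * s + b" "b < d"
proof
  show "k = d * (k div d) + k mod d" by simp
  show "k mod d < d" using d by simp
qed

lemma c_nonneg: "c k \<ge> 0"
proof (induction k rule: less_induct)
  case (less k)
  consider "k = 0" | "k = 1" | "k \<ge> 2" by linarith
  then show ?case
  proof cases
    case 3
    obtain s b where k: "k = d * s + b" "b < d" by (rule obtain_split)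
    have "c s \<ge> 0" using split_less(1)[OF k(2)] 3 k less.IH by simp
    moreover have "c (s + 1) ^ b \<ge> 0"
    proof (cases "b = 0")
      case False
      then have "c (s + 1) \<ge> 0" using split_less(2)[OF k(2)] 3 k by (intro less.IH) simp
      then show ?thesis by simp
    qed simp
    moreover have "real d ^ k - real d > 0" using power_diff_self_pos[OF d 3] .
    ultimately show ?thesis
      using c_rec[OF k(2), of s] 3 by (simp add: k(1))
  qed (use c0 c1 in auto)
qed

text \<open>Induction on the tree for all \<open>k\<close> simultaneously, because the root
  recursion for \<open>k\<close> involves the indices \<open>k\<close>, \<open>s\<close> and
  \<open>s + 1\<close> in the branches. The induction bounds turn the recursion into a polynomial in
  the leaf counts \<open>x i\<close>, to which the balanced Muirhead bound applies.\<close>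

lemma shape_count_le:
  "dary d t \<Longrightarrow> real (shape_count t (even_shape d k)) \<le> c k * real (num_leaves t) ^ k"
proof (induction t arbitrary: k)
  case (Node ts)
  consider "k = 0" | "k = 1" | "k \<ge> 2" "ts = []" | "k \<ge> 2" "ts \<noteq> []" by linarith
  then show ?case
  proof cases
    case 1
    then show ?thesis by (simp add: shape_count_None c0)
  next
    case 2
    then show ?thesis using shape_count_even_shape_1[of "Node ts" d] c1 by simp
  next
    case 3
    then show ?thesis using shape_count_leaf[OF d] c_nonneg by simp
  next
    case 4
    obtain s b where k: "k = d * s + b" "b < d" by (rule obtain_split)
    have ts: "length ts \<le> d" "\<And>t. t \<in> set ts \<Longrightarrow> dary d t"
      using Node.prems 4 by (auto simp: dary_Node)
    define x where "x i = (if i < length ts then real (num_leaves (ts ! i)) else 0)" for i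
    have x_nonneg: "x i \<ge> 0" for i by (simp add: x_def)
    have br: "real (branch_count ts i (even_shape d m)) \<le> c m * x i ^ m" for i m
    proof (cases "i < length ts")
      case True
      then show ?thesis
        using Node.IH[of "ts ! i" m] ts(2)[of "ts ! i"] by (simp add: branch_count_inside x_def)
    next
      case False
      \<comment> \<open>A padded branch has \<open>x i = 0\<close>. At \<open>m = 0\<close> both
        sides equal 1, since \<open>0 ^ 0 = 1\<close> and \<open>c 0 = 1\<close>; for
        \<open>m > 0\<close> the count is 0.\<close>
      then show ?thesis
        using c0 by (cases "m = 0") (simp_all add: branch_count_outside x_def zero_power)
    qed
    have sum_x: "(\<Sum>i<d. x i) = real (num_leaves (Node ts))"
    proof -
      have "(\<Sum>i<d. x i) = (\<Sum>i<length ts. x i)"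
        using ts(1) by (intro sum.mono_neutral_right) (auto simp: x_def)
      then show ?thesis using 4 by (simp add: num_leaves_Node x_def)
    qed
    define K where "K = c s ^ (d - b) * c (s + 1) ^ b"
    define M where "M = (\<Sum>B | B \<subseteq> {..<d} \<and> card B = b. \<Prod>i<d. x i ^ (s + of_bool (i \<in> B)))"
    have "K \<ge> 0" using c_nonneg by (simp add: K_def)
    have ck: "c k = real (d choose b) * (K / (real d ^ k - real d))"
      using c_rec[OF k(2), of s] 4 by (simp add: k(1) K_def)
    have pos: "real d ^ k - real d > 0" using power_diff_self_pos[OF d 4(1)] .
    have "(real d ^ k - real d) * M \<le> real (d choose b) * ((\<Sum>i<d. x i) ^ k - (\<Sum>i<d. x i ^ k))"
      unfolding M_def using x_nonneg 4(1) by (intro balanced_monomials_le k(1)) auto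
    \<comment> \<open>This scaling turns the factor \<open>d choose b\<close> on the right into
      \<open>c k\<close>: the denominator in the recursion for \<open>c\<close> is the number of
      nonconstant monomials.\<close>
    then have "K / (real d ^ k - real d) * ((real d ^ k - real d) * M) \<le>
        K / (real d ^ k - real d) * (real (d choose b) * ((\<Sum>i<d. x i) ^ k - (\<Sum>i<d. x i ^ k)))"
      using \<open>K \<ge> 0\<close> pos by (intro mult_left_mono) auto
    then have KM: "K * M \<le> c k * ((\<Sum>i<d. x i) ^ k - (\<Sum>i<d. x i ^ k))"
      using pos by (simp add: ck mult_ac)
    have prod_le: "(\<Prod>i<d. real (branch_count ts i (even_shape d (if i \<in> B then s + 1 else s)))) \<le>
        K * (\<Prod>i<d. x i ^ (s + of_bool (i \<in> B)))" if B: "B \<subseteq> {..<d}" "card B = b" for B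
    proof -
      have "(\<Prod>i<d. real (branch_count ts i (even_shape d (if i \<in> B then s + 1 else s)))) \<le>
          (\<Prod>i<d. (if i \<in> B then c (s + 1) else c s) * x i ^ (s + of_bool (i \<in> B)))"
      proof (rule prod_mono, intro conjI)
        fix i
        show "real (branch_count ts i (even_shape d (if i \<in> B then s + 1 else s))) \<le>
            (if i \<in> B then c (s + 1) else c s) * x i ^ (s + of_bool (i \<in> B))"
          using br[of i "if i \<in> B then s + 1 else s"] by (cases "i \<in> B") simp_all
      qed simp
      also have "\<dots> = K * (\<Prod>i<d. x i ^ (s + of_bool (i \<in> B)))"
        using prod_if_mem[OF B(1), of "c (s + 1)" "c s"] by (simp only: prod.distrib K_def B(2))
      finally show ?thesis .
    qed
    have "real (shape_count (Node ts) (even_shape d k)) =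
        (\<Sum>i<d. real (branch_count ts i (even_shape d k))) +
        (\<Sum>B | B \<subseteq> {..<d} \<and> card B = b.
          \<Prod>i<d. real (branch_count ts i (even_shape d (if i \<in> B then s + 1 else s))))"
      by (subst shape_count_Node[OF d k 4(1) 4(2) ts(1)]) simp
    also have "\<dots> \<le> (\<Sum>i<d. c k * x i ^ k) +
        (\<Sum>B | B \<subseteq> {..<d} \<and> card B = b. K * (\<Prod>i<d. x i ^ (s + of_bool (i \<in> B))))"
      using br prod_le by (intro add_mono sum_mono) auto
    also have "\<dots> = c k * (\<Sum>i<d. x i ^ k) + K * M"
      by (simp add: M_def sum_distrib_left)
    \<comment> \<open>The copies inside single branches contribute precisely the power sum that is
      subtracted in \<open>KM\<close>.\<close>
    also have "\<dots> \<le> c k * (\<Sum>i<d. x i) ^ k"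
      using KM by (simp add: right_diff_distrib)
    finally show ?thesis by (simp add: sum_x)
  qed
qed

end

section \<open>Complete trees and the lower bound\<close>

primrec complete_tree :: "nat \<Rightarrow> nat \<Rightarrow> rtree" where
  "complete_tree d 0 = Node []"
| "complete_tree d (Suc h) = Node (replicate d (complete_tree d h))"

lemma dary_complete_tree: "d \<ge> 2 \<Longrightarrow> dary d (complete_tree d h)"
  by (induction h) (auto simp: dary_Node)

lemma num_leaves_complete_tree: "d \<ge> 2 \<Longrightarrow> num_leaves (complete_tree d h) = d ^ h"
  by (induction h) (auto simp: num_leaves_Node num_leaves_Node_Nil)

text \<open>All branches are equal, so the \<open>d choose b\<close> subsets \<open>B\<close>
  contribute the same product.\<close>

lemma shape_count_complete_tree_Suc:
  assumes d: "d \<ge> 2" and k: "k = d * s + b" "b < d" "k \<ge> 2"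
  shows "shape_count (complete_tree d (Suc h)) (even_shape d k) =
    d * shape_count (complete_tree d h) (even_shape d k) +
    (d choose b) * (shape_count (complete_tree d h) (even_shape d s) ^ (d - b) *
      shape_count (complete_tree d h) (even_shape d (s + 1)) ^ b)"
proof -
  let ?a = "\<lambda>m. shape_count (complete_tree d h) (even_shape d m)"
  have br: "branch_count (replicate d (complete_tree d h)) i v = shape_count (complete_tree d h) v"
    if "i < d" for i v using that by (simp add: branch_count_inside)
  have "(\<Sum>B | B \<subseteq> {..<d} \<and> card B = b. \<Prod>i<d.
        branch_count (replicate d (complete_tree d h)) i (even_shape d (if i \<in> B then s + 1 else s))) =
      (\<Sum>B | B \<subseteq> {..<d} \<and> card B = b. ?a s ^ (d - b) * ?a (s + 1) ^ b)"
  proof (rule sum.cong[OF refl])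
    fix B assume B: "B \<in> {B. B \<subseteq> {..<d} \<and> card B = b}"
    have "(\<Prod>i<d. branch_count (replicate d (complete_tree d h)) i (even_shape d (if i \<in> B then s + 1 else s))) =
        (\<Prod>i<d. if i \<in> B then ?a (s + 1) else ?a s)"
      by (intro prod.cong) (auto simp: br)
    then show "(\<Prod>i<d. branch_count (replicate d (complete_tree d h)) i (even_shape d (if i \<in> B then s + 1 else s))) =
        ?a s ^ (d - b) * ?a (s + 1) ^ b"
      using B prod_if_mem[of B d "?a (s + 1)" "?a s"] by simp
  qed
  also have "\<dots> = (d choose b) * (?a s ^ (d - b) * ?a (s + 1) ^ b)"
    using n_subsets[of "{..<d}" b] by simp
  finally show ?thesis
    using d by (simp add: shape_count_Node[OF d k] br)
qed

text \<open>The limit is the fixed point \<open>l\<close> of \<open>l = q * l + L\<close>. The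
  distance to \<open>l\<close> shrinks by the factor \<open>q\<close> at each step, up to an error
  tending to zero.\<close>

lemma linear_recurrence_tendsto:
  fixes u v :: "nat \<Rightarrow> real"
  assumes rec: "\<And>n. u (Suc n) = q * u n + v n" and q: "0 \<le> q" "q < 1" and v: "v \<longlonglongrightarrow> L"
  shows "u \<longlonglongrightarrow> L / (1 - q)"
proof (rule LIMSEQ_I)
  fix r :: real assume r: "0 < r"
  define l where "l = L / (1 - q)"
  have l: "l = q * l + L" using q by (simp add: l_def field_simps)
  \<comment> \<open>With this tolerance for \<open>v\<close>, the value \<open>r / 2\<close> is the
    fixed point of the error recursion, so accumulated errors never exceed it.\<close>
  have "0 < r / 2 * (1 - q)" using r q by simp
  then obtain N where N: "\<And>n. n \<ge> N \<Longrightarrow> \<bar>v n - L\<bar> < r / 2 * (1 - q)"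
    using LIMSEQ_D[OF v] by (metis real_norm_def)
  have bound: "\<bar>u (N + j) - l\<bar> \<le> q ^ j * \<bar>u N - l\<bar> + r / 2" for j
  proof (induction j)
    case 0
    then show ?case using r by simp
  next
    case (Suc j)
    have "u (N + Suc j) - l = q * (u (N + j) - l) + (v (N + j) - L)"
      using l rec[of "N + j"] by (simp add: algebra_simps)
    then have "\<bar>u (N + Suc j) - l\<bar> \<le> q * \<bar>u (N + j) - l\<bar> + \<bar>v (N + j) - L\<bar>"
      using abs_triangle_ineq[of "q * (u (N + j) - l)" "v (N + j) - L"] q by (simp add: abs_mult)
    also have "\<dots> \<le> q * (q ^ j * \<bar>u N - l\<bar> + r / 2) + r / 2 * (1 - q)"
      using Suc.IH N[of "N + j"] q by (intro add_mono mult_left_mono) auto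
    also have "\<dots> = q ^ Suc j * \<bar>u N - l\<bar> + r / 2" by (simp add: field_simps)
    finally show ?case .
  qed
  have "(\<lambda>j. q ^ j * \<bar>u N - l\<bar>) \<longlonglongrightarrow> 0 * \<bar>u N - l\<bar>"
    using q by (intro tendsto_mult tendsto_const LIMSEQ_power_zero) auto
  then have "eventually (\<lambda>j. q ^ j * \<bar>u N - l\<bar> < r / 2) sequentially"
    using r by (intro order_tendstoD) auto
  then obtain J where J: "\<And>j. j \<ge> J \<Longrightarrow> q ^ j * \<bar>u N - l\<bar> < r / 2"
    by (auto simp: eventually_sequentially)
  show "\<exists>no. \<forall>n\<ge>no. norm (u n - L / (1 - q)) < r"
  proof (intro exI allI impI)
    fix n assume "n \<ge> N + J"
    then have "n = N + (n - N)" "n - N \<ge> J" by simp_all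
    with bound[of "n - N"] J[of "n - N"] have "\<bar>u n - l\<bar> < r" by simp
    then show "norm (u n - L / (1 - q)) < r" by (simp add: l_def)
  qed
qed

text \<open>\<open>fact k * (n choose k)\<close> is a falling factorial with \<open>k\<close>
  factors, each asymptotic to \<open>n\<close>.\<close>

lemma binomial_asymptotic:
  "(\<lambda>n. fact k * real (n choose k) / real n ^ k) \<longlonglongrightarrow> 1"
proof -
  have "(\<lambda>n. \<Prod>i\<in>{0..<k}. (real n - real i) / real n) \<longlonglongrightarrow> (\<Prod>i\<in>{0..<k}. 1)"
  proof (rule tendsto_prod)
    fix i
    have "(\<lambda>n. 1 - real i / real n) \<longlonglongrightarrow> 1 - 0"
      by (intro tendsto_diff tendsto_const lim_const_over_n)
    moreover have "eventually (\<lambda>n. 1 - real i / real n = (real n - real i) / real n) sequentially"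
      using eventually_gt_at_top[of 0] by eventually_elim (simp add: field_simps)
    ultimately show "(\<lambda>n. (real n - real i) / real n) \<longlonglongrightarrow> 1"
      by (simp add: tendsto_cong)
  qed
  moreover have "fact k * real (n choose k) / real n ^ k = (\<Prod>i\<in>{0..<k}. (real n - real i) / real n)" for n
    by (simp add: binomial_gbinomial gbinomial_mult_fact prod_dividef)
  ultimately show ?thesis by simp
qed

context even_tree_constants
begin

text \<open>After division by the \<open>k\<close>-th power of the leaf count, the recursion in the
  height is linear with contraction factor \<open>d / d ^ k\<close>. Its inhomogeneous term
  converges by induction on \<open>k\<close>, and its limit obeys the recursion defining
  \<open>c k\<close>.\<close>

lemma complete_tree_density_tendsto:
  "(\<lambda>h. real (shape_count (complete_tree d h) (even_shape d k)) / real (d ^ h) ^ k) \<longlonglongrightarrow> c k"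
proof (induction k rule: less_induct)
  case (less k)
  define \<alpha> where "\<alpha> m h = real (shape_count (complete_tree d h) (even_shape d m)) / real (d ^ h) ^ m" for m h
  have IH: "\<alpha> m \<longlonglongrightarrow> c m" if "m < k" for m
    using less.IH[OF that] by (simp add: \<alpha>_def[abs_def])
  consider "k = 0" | "k = 1" | "k \<ge> 2" by linarith
  then show ?case
  proof cases
    case 1
    then show ?thesis by (simp add: shape_count_None c0)
  next
    case 2
    have "real (shape_count (complete_tree d h) (even_shape d 1)) / real (d ^ h) ^ 1 = 1" for h
      using d unfolding shape_count_even_shape_1 by (simp add: num_leaves_complete_tree)
    then show ?thesis by (simp only: 2 c1 tendsto_const)
  next
    case 3
    obtain s b where k: "k = d * s + b" "b < d" by (rule obtain_split)
    have d0: "real d > 0" using d by simp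
    define q where "q = real d / real d ^ k"
    define v where "v h = real (d choose b) / real d ^ k * (\<alpha> s h ^ (d - b) * \<alpha> (s + 1) h ^ b)" for h
    have pos: "real d ^ k - real d > 0" using power_diff_self_pos[OF d 3] .
    have q: "0 \<le> q" "q < 1" using pos d0 by (simp_all add: q_def field_simps)
    have "\<alpha> k (Suc h) = q * \<alpha> k h + v h" for h
    proof -
      \<comment> \<open>The normalising exponents of the \<open>d\<close> branches add up to
        \<open>k\<close>.\<close>
      have e: "(d - b) * s + b * (s + 1) = k"
        using k by (simp add: diff_mult_distrib algebra_simps)
      have "\<alpha> s h ^ (d - b) * \<alpha> (s + 1) h ^ b =
          real (shape_count (complete_tree d h) (even_shape d s)) ^ (d - b) *
          real (shape_count (complete_tree d h) (even_shape d (s + 1))) ^ b /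
          real (d ^ h) ^ ((d - b) * s + b * (s + 1))"
        by (simp only: \<alpha>_def power_divide times_divide_times_eq power_add power_mult mult.commute[of _ s]
            mult.commute[of _ "s + 1"])
      then have v: "v h = real (d choose b) *
          (real (shape_count (complete_tree d h) (even_shape d s)) ^ (d - b) *
          real (shape_count (complete_tree d h) (even_shape d (s + 1))) ^ b) / (real d ^ k * real (d ^ h) ^ k)"
        unfolding v_def e by simp
      have "real (d ^ Suc h) ^ k = real d ^ k * real (d ^ h) ^ k" by (simp add: power_mult_distrib)
      then show ?thesis
        unfolding v q_def \<alpha>_def shape_count_complete_tree_Suc[OF d k 3]
        by (simp add: add_divide_distrib)
    qed
    moreover have "v \<longlonglongrightarrow> real (d choose b) / real d ^ k * (c s ^ (d - b) * c (s + 1) ^ b)"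
    proof -
      have "\<alpha> s \<longlonglongrightarrow> c s" using split_less(1)[OF k(2)] 3 k(1) by (intro IH) simp
      \<comment> \<open>The induction hypothesis is available at \<open>s + 1\<close> when
        \<open>b \<noteq> 0\<close>; for \<open>b = 0\<close> both powers are 1.\<close>
      moreover have "(\<lambda>h. \<alpha> (s + 1) h ^ b) \<longlonglongrightarrow> c (s + 1) ^ b"
      proof (cases "b = 0")
        case False
        then show ?thesis using split_less(2)[OF k(2)] 3 k(1) by (intro tendsto_power IH) simp
      qed simp
      ultimately show ?thesis
        unfolding v_def by (intro tendsto_mult[OF tendsto_const tendsto_mult] tendsto_power[of "\<alpha> s"])
    qed
    ultimately have "\<alpha> k \<longlonglongrightarrow> real (d choose b) / real d ^ k * (c s ^ (d - b) * c (s + 1) ^ b) / (1 - q)"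
      using q by (intro linear_recurrence_tendsto)
    also have "real (d choose b) / real d ^ k * (c s ^ (d - b) * c (s + 1) ^ b) / (1 - q) = c k"
    proof -
      \<comment> \<open>Multiplying by \<open>d ^ k\<close> gives \<open>d ^ k - d\<close>, the
        denominator in the recursion for \<open>c\<close>.\<close>
      have "1 - q = (real d ^ k - real d) / real d ^ k"
        using d0 by (simp add: q_def diff_divide_distrib)
      then show ?thesis
        using c_rec[OF k(2), of s] 3 d0 by (simp add: k(1))
    qed
    finally show ?thesis by (simp add: \<alpha>_def[abs_def])
  qed
qed

end

section \<open>Passage to the limit superior\<close>

lemma ex_dary_tree:
  assumes "d \<ge> 2"
  shows "n \<ge> 1 \<Longrightarrow> \<exists>t. dary d t \<and> num_leaves t = n"
proof (induction n rule: nat_induct_at_least)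
  case base
  have "dary d (Node [])" by (simp add: dary_Node)
  then show ?case using num_leaves_Node_Nil by blast
next
  case (Suc n)
  then obtain t where t: "dary d t" "num_leaves t = n" by blast
  have "dary d (Node [Node [], t])" using assms t by (simp add: dary_Node)
  moreover have "num_leaves (Node [Node [], t]) = Suc n"
    using t by (simp add: num_leaves_Node num_leaves_Node_Nil lessThan_Suc)
  ultimately show ?case by blast
qed

text \<open>No enumeration of trees is involved: the denominator is fixed by \<open>n\<close>, and
  the numerator is at most the number \<open>2 ^ n\<close> of leaf sets.\<close>

lemma finite_densities: "finite {density D t |t. dary d t \<and> num_leaves t = n}"
proof (rule finite_subset)
  show "{density D t |t. dary d t \<and> num_leaves t = n} \<subseteq>
    (\<lambda>m. real m / real (n choose num_leaves D)) ` {..2 ^ n}"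
  proof
    fix x assume "x \<in> {density D t |t. dary d t \<and> num_leaves t = n}"
    then obtain t where t: "x = density D t" "num_leaves t = n" by blast
    have "copies D t \<le> card (Pow (leaves t))"
      unfolding copies_def by (rule card_mono) (auto simp: finite_leaves)
    also have "\<dots> = 2 ^ n" using t(2) by (simp add: card_Pow finite_leaves num_leaves_def)
    finally show "x \<in> (\<lambda>m. real m / real (n choose num_leaves D)) ` {..2 ^ n}"
      using t by (auto simp: density_def)
  qed
qed simp

context even_tree_constants
begin

lemma density_even_tree:
  assumes "k \<ge> 1"
  shows "density (even_tree d k) t = real (shape_count t (even_shape d k)) / real (num_leaves t choose k)"
  using assms uleaves_even_tree[OF d assms]
  by (simp add: density_def copies_eq_shape_count even_shape_def num_leaves_eq_uleaves)

lemma inducibility_even_tree: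
  assumes k: "k \<ge> 1"
  shows "inducibility d (even_tree d k) = ereal (fact k * c k)"
proof (rule antisym)
  let ?M = "\<lambda>n. Max {density (even_tree d k) t |t. dary d t \<and> num_leaves t = n}"
  define R where "R n = fact k * real (n choose k) / real n ^ k" for n
  have R_lim: "R \<longlonglongrightarrow> 1" unfolding R_def by (rule binomial_asymptotic)
  \<comment> \<open>For \<open>n < k\<close> both sides vanish, since \<open>n choose k = 0\<close>
    and division by zero gives zero; hence \<open>upper\<close> also holds for these
    \<open>n\<close>.\<close>
  have factor: "y / real (n choose k) = fact k * (y / real n ^ k) / R n" if "n \<ge> 1" for y n
    using that by (simp add: R_def)
  have upper: "?M n \<le> fact k * c k / R n" if n: "n \<ge> 1" for n
  proof (rule Max.boundedI[OF finite_densities])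
    show "{density (even_tree d k) t |t. dary d t \<and> num_leaves t = n} \<noteq> {}"
      using ex_dary_tree[OF d n] by blast
    fix x assume "x \<in> {density (even_tree d k) t |t. dary d t \<and> num_leaves t = n}"
    then obtain t where t: "x = density (even_tree d k) t" "dary d t" "num_leaves t = n" by blast
    have "x \<le> c k * real n ^ k / real (n choose k)"
      using shape_count_le[OF t(2), of k] by (simp add: t density_even_tree[OF k] divide_right_mono)
    also have "\<dots> = fact k * c k / R n"
      using n by (simp add: factor)
    finally show "x \<le> fact k * c k / R n" .
  qed
  have "(\<lambda>n. fact k * c k / R n) \<longlonglongrightarrow> fact k * c k / 1"
    by (intro tendsto_divide tendsto_const R_lim) simp
  then have "limsup (\<lambda>n. ereal (fact k * c k / R n)) = ereal (fact k * c k)"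
    by (intro lim_imp_Limsup) simp_all
  moreover have "inducibility d (even_tree d k) \<le> limsup (\<lambda>n. ereal (fact k * c k / R n))"
    unfolding inducibility_def
  proof (rule Limsup_mono)
    show "\<forall>\<^sub>F n in sequentially. ereal (?M n) \<le> ereal (fact k * c k / R n)"
      using eventually_ge_at_top[of 1] by eventually_elim (simp add: upper)
  qed
  ultimately show "inducibility d (even_tree d k) \<le> ereal (fact k * c k)" by simp

  \<comment> \<open>For the lower bound only the sizes \<open>n = d ^ h\<close> are inspected: the
    limit superior along a subsequence is at most the full one.\<close>
  define x where "x h = density (even_tree d k) (complete_tree d h)" for h
  have d_pow: "strict_mono (\<lambda>h. d ^ h)"
    using d by (intro strict_monoI power_strict_increasing) auto
  have x_eq: "x h = fact k * (real (shape_count (complete_tree d h) (even_shape d k)) / real (d ^ h) ^ k) / R (d ^ h)" for h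
    unfolding x_def density_even_tree[OF k] num_leaves_complete_tree[OF d]
    using d by (intro factor) simp
  have "(\<lambda>h. R (d ^ h)) \<longlonglongrightarrow> 1"
    using LIMSEQ_subseq_LIMSEQ[OF R_lim d_pow] by (simp add: comp_def)
  then have "x \<longlonglongrightarrow> fact k * c k / 1"
    unfolding x_eq by (intro tendsto_divide tendsto_mult tendsto_const complete_tree_density_tendsto) simp_all
  then have "ereal (fact k * c k) = limsup (\<lambda>h. ereal (x h))"
    by (intro lim_imp_Limsup[symmetric]) simp_all
  also have "\<dots> \<le> limsup ((\<lambda>n. ereal (?M n)) \<circ> (\<lambda>h. d ^ h))"
  proof (intro Limsup_mono always_eventually allI)
    fix h
    have "x h \<le> ?M (d ^ h)"
      unfolding x_def using dary_complete_tree[OF d] num_leaves_complete_tree[OF d]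
      by (intro Max_ge[OF finite_densities]) blast
    then show "ereal (x h) \<le> ((\<lambda>n. ereal (?M n)) \<circ> (\<lambda>h. d ^ h)) h" by simp
  qed
  also have "\<dots> \<le> inducibility d (even_tree d k)"
    unfolding inducibility_def by (rule limsup_subseq_mono[OF d_pow])
  finally show "ereal (fact k * c k) \<le> inducibility d (even_tree d k)" .
qed

end

theorem theorem1:
  fixes d :: nat and c :: "nat \<Rightarrow> real"
  assumes "d \<ge> 2"
    and "c 0 = 1" and "c 1 = 1"
    and "\<And>s b. b \<in> {0..d - 1} \<Longrightarrow> d * s + b \<ge> 2 \<Longrightarrow>
           c (d * s + b) =
             real (d choose b) * (c s ^ (d - b) * c (s + 1) ^ b / (real d ^ (d * s + b) - real d))"
  shows "\<forall>k\<ge>1. inducibility d (even_tree d k) = ereal (fact k * c k)"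
proof -
  interpret even_tree_constants d c
    by unfold_locales (use assms in auto)
  show ?thesis
    using inducibility_even_tree by blast
qed

end
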